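(* Let $G = G_2(\alpha,\beta,\epsilon,\delta,-)$ be a metacyclic $2$-group of negative type with $\delta\ge 2$. (1) If $\beta=2$, then $\eta(G)=\alpha-\delta+3=\alpha+1$. (2) If $\beta\ge 3$, then $\eta(G)=g_2(\alpha-\delta+1,\beta-1)/2+2$.
   Context: For a finite group $G$, a maximal cyclic subgroup is a cyclic subgroup not properly contained in any other cyclic subgroup, and $\eta(G)$ is the number of conjugacy classes of maximal cyclic subgroups of $G$. Write $x^y = y^{-1}xy$. For integers $\alpha,\beta>0$, $\delta\ge 0$, $\epsilon\in\{0,1\}$ with $\delta\le\beta$, $\alpha-\delta\ge 2$ and $\delta+\epsilon\le\alpha$ (and $\beta\ge\delta+1$ when $\epsilon=1$), the metacyclic $2$-group of negative type is $$G_2(\alpha,\beta,\epsilon,\delta,-)=\langle x,y \mid x^{2^\alpha}=1,\ y^{2^\beta}=x^{2^{\alpha-\epsilon}},\ x^y=x^{r}\rangle,\quad r=2^{\alpha-\delta}-1.$$ It has order $2^{\alpha+\beta}$. (Since $\delta\le\beta$, the case $\beta=2$ with $\delta\ge2$ forces $\delta=2$.) For positive integers $a,b$, with $k=\max(a,b)$ and $l=\min(a,b)$, set $g_2(a,b)=2^{l-1}(k-l+3)$. *)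

theory Defs
  imports Complex_Main "HOL-Algebra.Group_Action" "HOL-Algebra.Elementary_Groups"
begin

section \<open>Groups given by a presentation\<close>

text \<open>
  A letter \<open>(s, False)\<close> stands for the generator \<open>s\<close> and \<open>(s, True)\<close> for its formal inverse.
  A relation \<open>u = v\<close> is a pair of words.
\<close>

type_synonym 's word = "('s \<times> bool) list"

definition gen_word :: "'s \<Rightarrow> 's word" where
  "gen_word s = [(s, False)]"

definition inv_gen_word :: "'s \<Rightarrow> 's word" where
  "inv_gen_word s = [(s, True)]"

definition gen_pow :: "'s \<Rightarrow> nat \<Rightarrow> 's word" where
  "gen_pow s n = replicate n (s, False)"

text \<open>
  The least congruence on the monoid of words that contains the defining relations and makes
  every letter inverse to its formal inverse: two words are related iff they represent the same
  element of the free group modulo the normal closure of the relators.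
\<close>

inductive word_cong :: "('s word \<times> 's word) set \<Rightarrow> 's word \<Rightarrow> 's word \<Rightarrow> bool"
  for R :: "('s word \<times> 's word) set" where
  refl: "word_cong R u u"
| sym: "word_cong R u v \<Longrightarrow> word_cong R v u"
| trans: "word_cong R u v \<Longrightarrow> word_cong R v w \<Longrightarrow> word_cong R u w"
| append: "word_cong R u u' \<Longrightarrow> word_cong R v v' \<Longrightarrow> word_cong R (u @ v) (u' @ v')"
| cancel: "word_cong R [(s, b), (s, \<not> b)] []"
| relation: "(u, v) \<in> R \<Longrightarrow> word_cong R u v"

definition word_rel :: "('s word \<times> 's word) set \<Rightarrow> ('s word \<times> 's word) set" where
  "word_rel R = {(u, v). word_cong R u v}"

definition word_class :: "('s word \<times> 's word) set \<Rightarrow> 's word \<Rightarrow> 's word set" where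
  "word_class R u = word_rel R `` {u}"

text \<open>The group with all elements of the type \<open>'s\<close> as generators and defining relations \<open>R\<close>.\<close>

definition presented_group :: "('s word \<times> 's word) set \<Rightarrow> 's word set monoid" where
  "presented_group R =
    \<lparr>carrier = UNIV // word_rel R,
     monoid.mult = (\<lambda>A B. \<Union>u\<in>A. \<Union>v\<in>B. word_class R (u @ v)),
     one = word_class R []\<rparr>"

lemma equiv_word_rel: "equiv UNIV (word_rel R)"
  unfolding equiv_def refl_on_def sym_def trans_def word_rel_def
  by (auto intro: word_cong.refl) (blast intro: word_cong.sym word_cong.trans)+

lemma word_class_eq_iff: "word_class R u = word_class R v \<longleftrightarrow> word_cong R u v"
  unfolding word_class_def using eq_equiv_class_iff[OF equiv_word_rel, of u v R]
  by (simp add: word_rel_def)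

lemma carrier_presented_group: "carrier (presented_group R) = range (word_class R)"
  by (auto simp: presented_group_def quotient_def word_class_def)

lemma one_presented_group: "\<one>\<^bsub>presented_group R\<^esub> = word_class R []"
  by (simp add: presented_group_def)

lemma mult_presented_group:
  "word_class R u \<otimes>\<^bsub>presented_group R\<^esub> word_class R v = word_class R (u @ v)"
proof -
  have "word_class R (u' @ v') = word_class R (u @ v)"
    if "u' \<in> word_class R u" "v' \<in> word_class R v" for u' v'
    unfolding word_class_eq_iff
    using that by (simp add: word_class_def word_rel_def word_cong.sym word_cong.append)
  moreover have "u \<in> word_class R u" "v \<in> word_class R v"
    by (simp_all add: word_class_def word_rel_def word_cong.refl)
  ultimately have "(\<Union>u'\<in>word_class R u. \<Union>v'\<in>word_class R v. word_class R (u' @ v'))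
      = word_class R (u @ v)"
    by blast
  thus ?thesis
    by (simp add: presented_group_def)
qed

lemma word_cong_left_inverse:
  "word_cong R (rev (map (\<lambda>(s, b). (s, \<not> b)) u) @ u) []"
proof (induction u)
  case Nil
  show ?case by (simp add: word_cong.refl)
next
  case (Cons a u)
  obtain s b where a: "a = (s, b)" by (cases a)
  let ?w = "rev (map (\<lambda>(s, b). (s, \<not> b)) u)"
  have "word_cong R ([(s, \<not> b), (s, b)] @ u) ([] @ u)"
    using word_cong.append[OF word_cong.cancel[of R s "\<not> b"] word_cong.refl] by simp
  hence "word_cong R (?w @ ([(s, \<not> b), (s, b)] @ u)) (?w @ u)"
    using word_cong.append[OF word_cong.refl] by fastforce
  from word_cong.trans[OF this Cons.IH] show ?case
    by (simp add: a)
qed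

lemma group_presented_group: "group (presented_group R)"
proof (rule groupI)
  fix A assume "A \<in> carrier (presented_group R)"
  then obtain u where A: "A = word_class R u"
    by (auto simp: carrier_presented_group)
  show "\<exists>B\<in>carrier (presented_group R). B \<otimes>\<^bsub>presented_group R\<^esub> A = \<one>\<^bsub>presented_group R\<^esub>"
    unfolding carrier_presented_group A one_presented_group
    by (rule bexI[of _ "word_class R (rev (map (\<lambda>(s, b). (s, \<not> b)) u))"])
      (auto simp: mult_presented_group word_class_eq_iff word_cong_left_inverse)
qed (auto simp: carrier_presented_group mult_presented_group one_presented_group)


section \<open>Metacyclic 2-groups of negative type\<close>

datatype xy = gen_x | gen_y

text \<open>The third relation is \<open>x\<^sup>y = x\<^sup>r\<close>, where \<open>x\<^sup>y\<close> is \<open>y\<^sup>-\<^sup>1 x y\<close>.\<close>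

definition G2_neg :: "nat \<Rightarrow> nat \<Rightarrow> nat \<Rightarrow> nat \<Rightarrow> xy word set monoid" where
  "G2_neg \<alpha> \<beta> \<epsilon> \<delta> = presented_group
    {(gen_pow gen_x (2 ^ \<alpha>), []),
     (gen_pow gen_y (2 ^ \<beta>), gen_pow gen_x (2 ^ (\<alpha> - \<epsilon>))),
     (inv_gen_word gen_y @ gen_word gen_x @ gen_word gen_y, gen_pow gen_x (2 ^ (\<alpha> - \<delta>) - 1))}"


section \<open>Conjugacy classes of maximal cyclic subgroups\<close>

definition cyclic_subgroup :: "'a set \<Rightarrow> ('a, 'b) monoid_scheme \<Rightarrow> bool" where
  "cyclic_subgroup H G \<longleftrightarrow> subgroup H G \<and> cyclic_group (G\<lparr>carrier := H\<rparr>)"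

definition maximal_cyclic_subgroups :: "('a, 'b) monoid_scheme \<Rightarrow> 'a set set" where
  "maximal_cyclic_subgroups G =
    {H. cyclic_subgroup H G \<and> \<not> (\<exists>K. cyclic_subgroup K G \<and> H \<subset> K)}"

definition eta :: "('a, 'b) monoid_scheme \<Rightarrow> nat" where
  "eta G = card (orbits G (maximal_cyclic_subgroups G)
                   (\<lambda>g H. g <#\<^bsub>G\<^esub> H #>\<^bsub>G\<^esub> (inv\<^bsub>G\<^esub> g)))"


text \<open>Only meant for positive arguments, where the truncated subtractions are exact.\<close>

definition g2 :: "nat \<Rightarrow> nat \<Rightarrow> nat" where
  "g2 a b = (let k = max a b; l = min a b in 2 ^ (l - 1) * (k - l + 3))"

end

theory Submission
  imports Defs "HOL-Number_Theory.Cong"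
begin

text \<open>
  Put \<open>m = \<alpha> - \<delta>\<close>, \<open>b = \<beta> - 1\<close> and \<open>r = 2^m - 1\<close>. Every element of the group is of the form
  \<open>y^j x^i\<close>. In a nontrivial group of 2-power exponent the maximal cyclic subgroups are those
  generated by nonsquares, so \<open>\<eta>\<close> counts the nonsquares up to conjugation and odd powers
  (\<open>eta_eq_card_representatives\<close>). Squaring \<open>y^k x^l\<close> shows that \<open>y^j x^i\<close> is a nonsquare in
  three cases: \<open>j\<close> is odd; \<open>j\<close> is even and \<open>i\<close> is odd; \<open>j\<close> is congruent to \<open>2\<close> modulo \<open>4\<close> and
  \<open>i\<close> is even, but not divisible by \<open>2^m\<close> (\<open>nonsquare_elt_iff\<close>).

  For odd \<open>j\<close> there are two classes, those of \<open>y\<close> and \<open>y x\<close>. For the other nonsquares the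
  decisive fact is that \<open>r^2 - 1\<close> is \<open>2^(m + 1)\<close> times an odd number: conjugation moves \<open>i\<close>
  through its whole residue class modulo \<open>2^(m + 1)\<close>, and besides that can only multiply it by
  \<open>r\<close>. Hence \<open>(j, i)\<close> matters modulo \<open>(2^\<beta>, 2^(m + 1))\<close>, up to common odd factors and up to
  multiplication of \<open>i\<close> by \<open>r\<close> (\<open>conj_odd_power_elt_imp\<close>, \<open>conj_odd_power_eltI\<close>). If \<open>i\<close> is odd,
  normalising \<open>i = 1\<close> leaves \<open>j / 2\<close> modulo \<open>2^b\<close> up to multiplication by \<open>r\<close> and by the units
  congruent to \<open>1\<close> modulo \<open>2^(m + 1)\<close>. If \<open>i\<close> is even, normalising \<open>j = 2\<close> leaves \<open>i\<close> modulo
  \<open>2^(m + 1)\<close> up to multiplication by \<open>r\<close> and by the units congruent to \<open>1\<close> modulo \<open>2^b\<close>.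

  Both are instances of one orbit problem, with the moduli interchanged: the residues modulo
  \<open>2^p\<close> under the group generated by \<open>r\<close>, which is \<open>3\<close> modulo \<open>4\<close>, and the units congruent to
  \<open>1\<close> modulo \<open>2^q\<close>. Its orbits are represented by \<open>2^(p - n) (4 d + 1)\<close> with \<open>n \<le> p\<close> and
  \<open>d < 2^(min n q - 2)\<close> (\<open>orbit_rep_exists\<close>, \<open>orbit_rep_unique\<close>). In the second family only
  \<open>2 \<le> n \<le> m\<close> give nonsquares with even \<open>i\<close>; the excluded classes for \<open>n = 0\<close> and \<open>n = 1\<close>
  contain the squares of \<open>y\<close> and \<open>y x\<close>, and the classes of \<open>y\<close> and \<open>y x\<close> themselves compensate
  for them. So \<open>\<eta>\<close> is the sum of \<open>2^(min n (m + 1) - 2)\<close> over \<open>n \<le> b\<close> plus the sum of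
  \<open>2^(min n b - 2)\<close> over \<open>n \<le> m\<close>, and each of these is the sum of a geometric progression and a
  constant tail.

  The presentation enters twice: its relations give the normal form and the rules of
  calculation, and the exponents of \<open>y\<close> and \<open>x\<close> of a word, taken modulo \<open>2^\<beta>\<close> and \<open>2^(m + 1)\<close>,
  are invariant under them, which shows that the representatives are really distinct
  (\<open>word_cong_exponents\<close>).
\<close>


section \<open>Powers and inverses of odd numbers modulo powers of two\<close>

lemma cong_2_iff: "[i = i'] (mod 2) \<longleftrightarrow> (even i \<longleftrightarrow> even i')" for i i' :: nat
  by (auto simp: cong_def parity_cases even_iff_mod_2_eq_zero odd_iff_mod_2_eq_one)

lemma cong_two_power_Suc_imp_parity:
  "[i = i'] (mod 2 ^ Suc k) \<Longrightarrow> even i \<longleftrightarrow> even i'" for i i' :: nat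
  unfolding cong_2_iff[symmetric] by (erule cong_dvd_modulus_nat) simp

lemma two_power_eq_4_times: "2 \<le> k \<Longrightarrow> (2::nat) ^ k = 4 * 2 ^ (k - 2)"
  by (auto simp: le_iff_add power_add)

text \<open>
  The cofactor \<open>c\<close> is the geometric sum \<open>1 + a + \<dots> + a^(k - 1)\<close> of \<open>k\<close> odd terms. It shows that
  raising to an odd power does not change the 2-adic valuation of \<open>a - 1\<close>.
\<close>

lemma odd_power_eq_one_plus:
  fixes a :: nat
  assumes "odd a"
  shows "\<exists>c. a ^ k = 1 + (a - 1) * c \<and> (odd c \<longleftrightarrow> odd k)"
proof (induction k)
  case 0
  show ?case by (rule exI[of _ 0]) simp
next
  case (Suc k)
  then obtain c where c: "a ^ k = 1 + (a - 1) * c" "odd c \<longleftrightarrow> odd k" by blast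
  obtain b where b: "a = 1 + b" using assms by (metis odd_pos le_add_diff_inverse less_eq_Suc_le One_nat_def)
  have "a ^ Suc k = 1 + (a - 1) * (1 + a * c)"
    using c(1) by (simp add: b algebra_simps)
  moreover have "odd (1 + a * c) \<longleftrightarrow> odd (Suc k)" using c(2) assms by simp
  ultimately show ?case by blast
qed

text \<open>
  For odd \<open>k\<close> the number \<open>a + 1\<close> divides \<open>a^k + 1\<close> and the quotient is odd, so \<open>a^k + 1\<close> and
  \<open>a + 1\<close> have the same 2-adic valuation. Write \<open>a^k\<close> as \<open>a\<close> times a power of the odd number
  \<open>a^2\<close>.
\<close>

lemma odd_power_plus_one:
  fixes a :: nat
  assumes "odd a" "odd k"
  shows "\<exists>c. odd c \<and> a ^ k + 1 = (a + 1) * c"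
proof -
  obtain c where c: "(a ^ 2) ^ (k div 2) = 1 + (a ^ 2 - 1) * c"
    using odd_power_eq_one_plus[of "a ^ 2"] assms by auto
  obtain b where b: "a = 1 + b" using assms by (metis odd_pos le_add_diff_inverse less_eq_Suc_le One_nat_def)
  have "a ^ k = a * (a ^ 2) ^ (k div 2)"
    unfolding power_mult[symmetric] power_Suc[symmetric] using assms(2) by simp
  also have "\<dots> + 1 = (a + 1) * (1 + a * b * c)"
    unfolding c by (simp add: b power2_eq_square algebra_simps)
  finally have "a ^ k + 1 = (a + 1) * (1 + a * b * c)" .
  moreover have "even b" using assms(1) b by simp
  ultimately show ?thesis by (intro exI[of _ "1 + a * b * c"]) simp
qed

lemma odd_inverse_mod_power_2:
  fixes c :: nat
  assumes "odd c"
  shows "\<exists>u. odd u \<and> [c * u = 1] (mod 2 ^ n)"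
proof -
  have "coprime c (2 ^ Suc n)" using assms by simp
  then obtain u where u: "[c * u = 1] (mod 2 ^ Suc n)" using cong_solve_coprime_nat by (metis One_nat_def)
  have "[c * u = 1] (mod 2)" using u by (rule cong_dvd_modulus_nat) simp
  hence "odd u" by (auto simp: cong_def)
  moreover have "[c * u = 1] (mod 2 ^ n)" using u by (rule cong_dvd_modulus_nat) simp
  ultimately show ?thesis by blast
qed

lemma solve_linear_cong_power_2:
  fixes c i i' :: nat
  assumes "odd c" "[i = i'] (mod 2 ^ s)"
  shows "\<exists>l. [i = l * (2 ^ s * c) + i'] (mod 2 ^ n)"
proof -
  obtain u where u: "[c * u = 1] (mod 2 ^ n)" using odd_inverse_mod_power_2[OF assms(1)] by blast
  have "[int i = int i'] (mod 2 ^ s)" using assms(2) by (metis cong_int_iff of_nat_numeral of_nat_power)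
  then obtain t where t: "int i - int i' = 2 ^ s * t" by (auto simp: cong_iff_dvd_diff dvd_def)
  define l where "l = nat ((t * int u) mod 2 ^ n)"
  have l: "[int l = t * int u] (mod 2 ^ n)" by (simp add: l_def)
  have u': "[int c * int u = 1] (mod 2 ^ n)"
    using u by (metis cong_int_iff of_nat_1 of_nat_mult of_nat_numeral of_nat_power)
  have "[int l * (2 ^ s * int c) + int i' = t * int u * (2 ^ s * int c) + int i'] (mod 2 ^ n)"
    by (intro cong_add cong_mult l cong_refl)
  also have "t * int u * (2 ^ s * int c) + int i' = (int c * int u) * (2 ^ s * t) + int i'"
    by (simp add: algebra_simps)
  also have "[\<dots> = 1 * (2 ^ s * t) + int i'] (mod 2 ^ n)"
    by (intro cong_add cong_mult u' cong_refl)
  also have "1 * (2 ^ s * t) + int i' = int i" using t by simp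
  finally have "[int (l * (2 ^ s * c) + i') = int i] (mod int (2 ^ n))" by simp
  hence "[i = l * (2 ^ s * c) + i'] (mod 2 ^ n)" unfolding cong_int_iff by (rule cong_sym)
  thus ?thesis by blast
qed

text \<open>
  Each squaring adds exactly one factor of two to the difference from \<open>1\<close>, since
  \<open>(1 + 2^t c)^2 = 1 + 2^(t + 1) (c + 2^(t - 1) c^2)\<close>, and the last factor is odd for \<open>t \<ge> 2\<close>.
\<close>

lemma two_power_power_of_one_plus:
  fixes c :: nat
  assumes "odd c" "s \<ge> 2"
  shows "\<exists>c'. odd c' \<and> (1 + 2 ^ s * c) ^ (2 ^ k) = 1 + 2 ^ (s + k) * c'"
proof (induction k)
  case 0
  show ?case using assms by auto
next
  case (Suc k)
  then obtain c' where c': "odd c'" "(1 + 2 ^ s * c) ^ (2 ^ k) = 1 + 2 ^ (s + k) * c'" by blast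
  have e: "(1 + 2 ^ s * c) ^ (2 ^ Suc k) = ((1 + 2 ^ s * c) ^ (2 ^ k)) ^ 2"
    by (simp add: power_mult[symmetric] mult.commute)
  obtain t where t: "s + k = Suc (Suc t)" using assms(2) by (metis add_2_eq_Suc le_Suc_ex trans_le_add1)
  have q: "(2::nat) ^ (s + k) = 4 * 2 ^ t" by (simp add: t)
  have "(1 + 2 ^ s * c) ^ (2 ^ Suc k) = (1 + 2 ^ (s + k) * c') ^ 2"
    unfolding e c'(2) ..
  also have "\<dots> = 1 + 2 ^ (s + Suc k) * (c' + 2 * (2 ^ t * c' ^ 2))"
    unfolding add_Suc_right power_Suc q by (simp add: power2_eq_square algebra_simps)
  finally have "(1 + 2 ^ s * c) ^ (2 ^ Suc k) = 1 + 2 ^ (s + Suc k) * (c' + 2 * (2 ^ t * c' ^ 2))" .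
  with c'(1) show ?case by (intro exI[of _ "c' + 2 * (2 ^ t * c' ^ 2)"]) simp
qed

text \<open>
  A number that exceeds \<open>1\<close> by exactly \<open>s \<ge> 2\<close> factors of two generates the group of all units
  congruent to \<open>1\<close> modulo \<open>2^s\<close>. The exponent is built one binary digit at a time: if the
  current power is wrong modulo \<open>2^(n + 1)\<close>, adding \<open>2^(n - s)\<close> to the exponent adds an odd
  multiple of \<open>2^n\<close>.
\<close>

lemma power_of_one_plus_surj:
  fixes a c :: nat
  assumes "odd c" "s \<ge> 2" "[a = 1] (mod 2 ^ s)"
  shows "\<exists>k. [(1 + 2 ^ s * c) ^ k = a] (mod 2 ^ n)"
proof (induction n)
  case 0
  show ?case by simp
next
  case (Suc n)
  show ?case
  proof (cases "n < s")
    case True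
    have "[a = 1] (mod 2 ^ Suc n)"
      using assms(3) True by (meson cong_dvd_modulus_nat le_imp_power_dvd Suc_leI)
    thus ?thesis by (intro exI[of _ 0]) (simp add: cong_sym_eq)
  next
    case False
    let ?r = "1 + 2 ^ s * c"
    from Suc obtain k where k: "[?r ^ k = a] (mod 2 ^ n)" by blast
    hence "[int a = int (?r ^ k)] (mod int (2 ^ n))" by (simp only: cong_int_iff cong_sym_eq)
    then obtain t where t: "int a - int (?r ^ k) = 2 ^ n * t" by (auto simp: cong_iff_dvd_diff dvd_def)
    show ?thesis
    proof (cases "even t")
      case True
      have "[int a = int (?r ^ k)] (mod int (2 ^ Suc n))"
        unfolding cong_iff_dvd_diff t using True by auto
      thus ?thesis unfolding cong_int_iff using cong_sym by blast
    next
      case odd: False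
      obtain c' where c': "odd c'" "?r ^ (2 ^ (n - s)) = 1 + 2 ^ n * c'"
        using two_power_power_of_one_plus[OF assms(1,2), of "n - s"] False by auto
      have ro: "odd (?r ^ k)" using assms(2) by simp
      have "int a - int (?r ^ (k + 2 ^ (n - s))) = 2 ^ n * (t - int (?r ^ k * c'))"
        unfolding power_add c'(2) using t by (simp add: algebra_simps)
      moreover have "even (t - int (?r ^ k * c'))"
        using odd ro c'(1) by (simp del: of_nat_power of_nat_add)
      ultimately have "[int a = int (?r ^ (k + 2 ^ (n - s)))] (mod int (2 ^ Suc n))"
        unfolding cong_iff_dvd_diff by auto
      thus ?thesis unfolding cong_int_iff using cong_sym by blast
    qed
  qed
qed


section \<open>Orbits of a group of units on the residues modulo a power of two\<close>

text \<open>
  Let \<open>r\<close> be congruent to \<open>3\<close> modulo \<open>4\<close>, and let the units congruent to \<open>1\<close> modulo \<open>2^q\<close>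
  together with \<open>r\<close> act by multiplication on the residues modulo \<open>2^p\<close>. The residues of additive
  order \<open>2^n\<close> are the \<open>2^(p - n) c\<close> with \<open>c\<close> an odd number modulo \<open>2^n\<close>. Multiplication by \<open>r\<close>
  makes \<open>c\<close> congruent to \<open>1\<close> modulo \<open>4\<close>, and then the remaining units leave only the residue of
  \<open>c\<close> modulo \<open>2^(min n q)\<close>.
\<close>

definition orbit_rep :: "nat \<Rightarrow> nat \<times> nat \<Rightarrow> nat" where
  "orbit_rep p = (\<lambda>(n, d). 2 ^ (p - n) * (4 * d + 1))"

text \<open>
  In each order \<open>2^n\<close> the odd parts \<open>4 d + 1 < 2^(min n q)\<close> remain. For \<open>min n q < 2\<close> there is a
  single orbit, and the truncated subtraction in the exponent gives just \<open>d = 0\<close>.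
\<close>

definition orbit_index :: "nat \<Rightarrow> nat set \<Rightarrow> (nat \<times> nat) set" where
  "orbit_index q N = (SIGMA n:N. {..<2 ^ (min n q - 2)})"

text \<open>
  If \<open>n \<le> q\<close>, reducing the normalised odd part \<open>c0\<close> modulo \<open>2^n\<close> changes nothing modulo \<open>2^p\<close>.
  If \<open>q < n\<close>, the quotient of the reduced odd part \<open>c'\<close> by \<open>c0\<close> is a unit congruent to \<open>1\<close>
  modulo \<open>2^q\<close>, hence available.
\<close>

lemma orbit_rep_exists:
  fixes r v :: nat
  assumes "r mod 4 = 3"
  shows "\<exists>z \<in> orbit_index q {..p}. \<exists>u e. odd u \<and> [u = 1] (mod 2 ^ q) \<and>
           [u * r ^ e * v = orbit_rep p z] (mod 2 ^ p)"
proof (cases "2 ^ p dvd v")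
  case True
  have "[1 * r ^ 0 * v = orbit_rep p (0, 0)] (mod 2 ^ p)"
    using True by (simp add: orbit_rep_def cong_def)
  moreover have "(0, 0) \<in> orbit_index q {..p}" by (simp add: orbit_index_def)
  ultimately show ?thesis by (metis cong_refl odd_one)
next
  case False
  hence "v \<noteq> 0" by (metis dvd_0_right)
  then obtain t c where tc: "v = 2 ^ t * c" "odd c"
    using multiplicity_decompose'[of v 2] by (metis odd_one)
  have "t < p" using False tc(1) by (metis dvd_triv_left le_imp_power_dvd dvd_trans not_le)
  define n where "n = p - t"
  have n: "n \<ge> 1" "n \<le> p" "t + n = p" using \<open>t < p\<close> by (auto simp: n_def)
  \<comment> \<open>multiply by \<open>r\<close> exactly when this is needed to make the odd part congruent to \<open>1\<close> modulo \<open>4\<close>\<close>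
  define e :: nat where "e = (if c mod 4 = 1 then 0 else 1)"
  define c0 where "c0 = r ^ e * c"
  have "c mod 4 = 1 \<or> c mod 4 = 3" using tc(2) by presburger
  hence c0: "c0 mod 4 = 1"
    using assms by (auto simp: c0_def e_def mod_mult_eq[of r 4 c, symmetric])
  hence oc0: "odd c0" by presburger
  define M where "M = min n q"
  define c' where "c' = (if M \<le> 1 then 1 else c0 mod 2 ^ M)"
  have c'c0: "[c' = c0] (mod 2 ^ M)"
  proof (cases "M \<le> 1")
    case True
    hence "[1 = c0] (mod 2 ^ M)" using oc0
      by (cases M) (auto simp: cong_def odd_iff_mod_2_eq_one)
    thus ?thesis using True by (simp add: c'_def)
  qed (simp add: c'_def)
  have "\<exists>d < 2 ^ (M - 2). c' = 4 * d + 1"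
  proof (cases "M \<le> 1")
    case True
    thus ?thesis by (simp add: c'_def)
  next
    case False
    hence M: "(2::nat) ^ M = 4 * 2 ^ (M - 2)"
      by (intro two_power_eq_4_times) simp
    have "c' mod 4 = 1" using c0 False by (simp add: c'_def M mod_mod_cancel)
    moreover have "c' < 4 * 2 ^ (M - 2)" using False by (simp add: c'_def M)
    ultimately show ?thesis by (intro exI[of _ "c' div 4"]) (metis less_mult_imp_div_less mult.commute mult_div_mod_eq)
  qed
  then obtain d where d: "d < 2 ^ (M - 2)" "c' = 4 * d + 1" by blast
  have "\<exists>u. odd u \<and> [u = 1] (mod 2 ^ q) \<and> [u * c0 = c'] (mod 2 ^ n)"
  proof (cases "n \<le> q")
    case True
    thus ?thesis using c'c0 by (intro exI[of _ 1]) (simp add: M_def cong_sym_eq)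
  next
    case False
    hence M: "M = q" "q \<le> n" by (auto simp: M_def)
    obtain w where w: "odd w" "[c0 * w = 1] (mod 2 ^ n)" using odd_inverse_mod_power_2[OF oc0] by blast
    have "[c' * w = c0 * w] (mod 2 ^ q)" using c'c0 M by (intro cong_mult) auto
    also have "[c0 * w = 1] (mod 2 ^ q)" using w(2) M(2) by (meson cong_dvd_modulus_nat le_imp_power_dvd)
    finally have "[c' * w = 1] (mod 2 ^ q)" .
    moreover have "[c' * (c0 * w) = c' * 1] (mod 2 ^ n)" by (intro cong_mult w cong_refl)
    hence "[c' * w * c0 = c'] (mod 2 ^ n)" by (simp add: ac_simps)
    moreover have "odd (c' * w)" using d(2) w(1) by simp
    ultimately show ?thesis by blast
  qed
  then obtain u where u: "odd u" "[u = 1] (mod 2 ^ q)" "[u * c0 = c'] (mod 2 ^ n)" by blast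
  have "[2 ^ t * (u * c0) = 2 ^ t * c'] (mod 2 ^ p)"
    unfolding n(3)[symmetric] power_add using u(3) by (rule cong_cmult_leftI)
  hence "[u * r ^ e * v = 2 ^ t * c'] (mod 2 ^ p)"
    by (simp add: tc c0_def ac_simps)
  moreover have "2 ^ t * c' = orbit_rep p (n, d)" using n d(2) by (simp add: orbit_rep_def n_def)
  moreover have "(n, d) \<in> orbit_index q {..p}" using n d(1) by (simp add: orbit_index_def M_def)
  ultimately show ?thesis using u(1,2) by metis
qed

lemma cong_two_power_times_odd:
  fixes A B :: nat
  assumes "odd A" "odd B" "s \<le> p" "t \<le> p" "[2 ^ s * A = 2 ^ t * B] (mod 2 ^ p)"
  shows "s = t" "[A = B] (mod 2 ^ (p - s))"
proof -
  have *: False if "odd A" "t \<le> p" "s < t" "[2 ^ s * A = 2 ^ t * B] (mod 2 ^ p)" for s t A B :: nat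
  proof -
    have "[2 ^ s * A = 2 ^ t * B] (mod 2 ^ t)" using that by (meson cong_dvd_modulus_nat le_imp_power_dvd)
    hence "2 ^ t dvd 2 ^ s * A" by (simp add: cong_def mod_eq_0_iff_dvd)
    moreover have "(2::nat) ^ t = 2 ^ s * 2 ^ (t - s)" using \<open>s < t\<close> by (simp flip: power_add)
    ultimately have "2 ^ (t - s) dvd A" by simp
    thus False using \<open>odd A\<close> \<open>s < t\<close> by (metis dvd_power dvd_trans zero_less_diff)
  qed
  show st: "s = t"
    using *[OF assms(1,4) _ assms(5)] *[OF assms(2,3) _ cong_sym[OF assms(5)]] by (metis linorder_neqE_nat)
  have "(2::nat) ^ p = 2 ^ s * 2 ^ (p - s)" using assms(3) by (simp flip: power_add)
  thus "[A = B] (mod 2 ^ (p - s))" using assms(5) unfolding st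
    by (simp add: cong_def flip: mult_mod_right)
qed

text \<open>
  The number \<open>n\<close> is recovered from the 2-adic valuation. When both \<open>n\<close> and \<open>q\<close> are at least \<open>3\<close>,
  comparing the odd parts modulo \<open>4\<close> forces \<open>w\<close> to be congruent to \<open>1\<close> rather than to \<open>r\<close> modulo
  \<open>2^(min n q)\<close>, and then \<open>d\<close> is determined.
\<close>

lemma orbit_rep_unique:
  fixes r w :: nat
  assumes r: "r mod 4 = 3" and N: "N \<subseteq> {..p}" and w: "odd w" "[w = 1] (mod 2 ^ q) \<or> [w = r] (mod 2 ^ q)"
    and z: "z \<in> orbit_index q N" "z' \<in> orbit_index q N"
    and eq: "[w * orbit_rep p z = orbit_rep p z'] (mod 2 ^ p)"
  shows "z = z'"
proof -
  obtain n d where nd: "z = (n, d)" "n \<le> p" "d < 2 ^ (min n q - 2)"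
    using z(1) N by (auto simp: orbit_index_def)
  obtain n' d' where nd': "z' = (n', d')" "n' \<le> p" "d' < 2 ^ (min n' q - 2)"
    using z(2) N by (auto simp: orbit_index_def)
  have e: "[2 ^ (p - n) * (w * (4 * d + 1)) = 2 ^ (p - n') * (4 * d' + 1)] (mod 2 ^ p)"
    using eq unfolding nd nd' orbit_rep_def split by (simp only: mult.left_commute)
  have o: "odd (w * (4 * d + 1))" "odd (4 * d' + 1)" using w by auto
  note * = cong_two_power_times_odd[OF o _ _ e]
  have "p - n = p - n'" using * by simp
  hence n: "n = n'" using nd nd' by auto
  have c: "[w * (4 * d + 1) = 4 * d' + 1] (mod 2 ^ n)" using *(2) nd by simp
  have "d = d'"
  proof (cases "min n q \<le> 2")
    case True
    thus ?thesis using nd nd' n by simp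
  next
    case False
    let ?M = "min n q"
    have M: "(2::nat) ^ ?M = 4 * 2 ^ (?M - 2)"
      using False by (intro two_power_eq_4_times) linarith
    hence 4: "4 dvd (2::nat) ^ ?M" by simp
    have cM: "[w * (4 * d + 1) = 4 * d' + 1] (mod 2 ^ ?M)"
      using c by (rule cong_dvd_modulus_nat) (simp add: le_imp_power_dvd)
    hence "[w * (4 * d + 1) = 4 * d' + 1] (mod 4)" using 4 by (rule cong_dvd_modulus_nat)
    moreover have "w * (4 * d + 1) = w + 4 * (w * d)" by (simp add: algebra_simps)
    ultimately have "[w + 4 * (w * d) = 4 * d' + 1] (mod 4)" by (simp only:)
    hence w4: "w mod 4 = 1" by (simp add: cong_def)
    have wM: "[w = 1] (mod 2 ^ ?M) \<or> [w = r] (mod 2 ^ ?M)"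
      using w(2) by (meson cong_dvd_modulus_nat le_imp_power_dvd min.cobounded2)
    moreover have "\<not> [w = r] (mod 2 ^ ?M)"
    proof
      assume "[w = r] (mod 2 ^ ?M)"
      hence "[w = r] (mod 4)" using 4 by (rule cong_dvd_modulus_nat)
      thus False using w4 r by (simp add: cong_def)
    qed
    ultimately have "[w = 1] (mod 2 ^ ?M)" by blast
    hence "[w * (4 * d + 1) = 1 * (4 * d + 1)] (mod 2 ^ ?M)" by (intro cong_mult cong_refl)
    hence "[4 * d + 1 = 4 * d' + 1] (mod 2 ^ ?M)" using cM by (metis cong_sym cong_trans mult_1)
    moreover have "4 * d + 1 < 2 ^ ?M" "4 * d' + 1 < 2 ^ ?M" using nd nd' n unfolding M by auto
    ultimately show ?thesis using cong_less_modulus_unique_nat by fastforce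
  qed
  thus ?thesis using n nd nd' by simp
qed

lemma inj_on_orbit_rep:
  assumes "N \<subseteq> {..p}"
  shows "inj_on (orbit_rep p) (orbit_index q N)"
proof (rule inj_onI)
  fix z z' assume z: "z \<in> orbit_index q N" "z' \<in> orbit_index q N" "orbit_rep p z = orbit_rep p z'"
  show "z = z'"
    by (rule orbit_rep_unique[OF _ assms _ _ z(1,2), of 3 1]) (simp_all add: z(3))
qed

lemma card_orbit_index: "finite N \<Longrightarrow> card (orbit_index q N) = (\<Sum>n\<in>N. 2 ^ (min n q - 2))"
  by (simp add: orbit_index_def)


section \<open>Maximal cyclic subgroups in groups of 2-power exponent\<close>

definition nonsquares :: "('a, 'b) monoid_scheme \<Rightarrow> 'a set" where
  "nonsquares G = {g \<in> carrier G. \<not> (\<exists>h\<in>carrier G. g = h \<otimes>\<^bsub>G\<^esub> h)}"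

text \<open>
  Conjugacy of \<open>g'\<close> to an odd power of \<open>g\<close>, written without the inverse of \<open>h\<close> so that it can be
  verified by multiplying normal forms.
\<close>

definition conj_odd_power :: "('a, 'b) monoid_scheme \<Rightarrow> 'a \<Rightarrow> 'a \<Rightarrow> bool" where
  "conj_odd_power G g g' \<longleftrightarrow>
     (\<exists>h\<in>carrier G. \<exists>u::nat. odd u \<and> h \<otimes>\<^bsub>G\<^esub> g' = (g [^]\<^bsub>G\<^esub> u) \<otimes>\<^bsub>G\<^esub> h)"

abbreviation conj_orbit :: "('a, 'b) monoid_scheme \<Rightarrow> 'a set \<Rightarrow> 'a set set" where
  "conj_orbit G \<equiv> orbit G (\<lambda>g H. g <#\<^bsub>G\<^esub> H #>\<^bsub>G\<^esub> (inv\<^bsub>G\<^esub> g))"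

context group begin

lemma pow_cong:
  fixes k l :: nat
  assumes "g \<in> carrier G" "g [^] n = \<one>" "[k = l] (mod n)"
  shows "g [^] k = g [^] l"
proof -
  have *: "g [^] (a + n * t) = g [^] a" for a t :: nat
    using assms(1,2) by (simp flip: nat_pow_mult nat_pow_pow)
  obtain t1 t2 where "l + t1 * n = k + t2 * n" using assms(3) by (auto simp: cong_iff_lin_nat)
  thus ?thesis using *[of l t1] *[of k t2] by (simp add: mult.commute)
qed

lemma conj_nat_pow:
  assumes "h \<in> carrier G" "g \<in> carrier G"
  shows "(h \<otimes> g \<otimes> inv h) [^] (k::nat) = h \<otimes> (g [^] k) \<otimes> inv h"
proof (induction k)
  case (Suc k)
  have "inv h \<otimes> (h \<otimes> (g \<otimes> inv h)) = g \<otimes> inv h"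
    using assms by (simp flip: m_assoc)
  hence "(h \<otimes> g \<otimes> inv h) [^] Suc k = h \<otimes> (g [^] k) \<otimes> (g \<otimes> inv h)"
    using assms Suc by (simp add: m_assoc)
  also have "\<dots> = h \<otimes> (g [^] Suc k) \<otimes> inv h"
    using assms by (simp add: m_assoc)
  finally show ?case .
qed (use assms in simp)

lemma cyclic_subgroup_iff_generate:
  "cyclic_subgroup H G \<longleftrightarrow> (\<exists>g\<in>carrier G. H = generate G {g})"
proof
  assume H: "cyclic_subgroup H G"
  hence s: "subgroup H G" by (simp add: cyclic_subgroup_def)
  interpret S: group "G\<lparr>carrier := H\<rparr>" by (rule subgroup.subgroup_is_group[OF s is_group])
  obtain g where g: "g \<in> H" "H = range (\<lambda>n::int. g [^]\<^bsub>G\<lparr>carrier := H\<rparr>\<^esub> n)"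
    using H S.cyclic_group by (auto simp: cyclic_subgroup_def)
  have "H = range (\<lambda>n::int. g [^] n)"
    using g int_pow_consistent[OF s g(1)] by simp
  moreover have "g \<in> carrier G" using g(1) s by (rule subgroup.mem_carrier[rotated])
  ultimately show "\<exists>g\<in>carrier G. H = generate G {g}" by (auto simp: generate_pow)
next
  assume "\<exists>g\<in>carrier G. H = generate G {g}"
  then obtain g where g: "g \<in> carrier G" "H = generate G {g}" by blast
  have s: "subgroup H G" using g by (simp add: generate_is_subgroup)
  interpret S: group "G\<lparr>carrier := H\<rparr>" by (rule subgroup.subgroup_is_group[OF s is_group])
  have gH: "g \<in> H" using g generate.incl[of g "{g}" G] by simp
  have "H = range (\<lambda>n::int. g [^] n)" using g generate_pow by auto
  hence "H = range (\<lambda>n::int. g [^]\<^bsub>G\<lparr>carrier := H\<rparr>\<^esub> n)"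
    using int_pow_consistent[OF s gH] by simp
  thus "cyclic_subgroup H G" using gH s S.cyclic_group by (auto simp: cyclic_subgroup_def)
qed

end

locale two_power_exponent_group = group G for G (structure) +
  fixes K :: nat
  assumes pow_exponent: "g \<in> carrier G \<Longrightarrow> g [^] (2 ^ K :: nat) = \<one>"
begin

lemma generate_eq_nat_powers:
  assumes "g \<in> carrier G"
  shows "generate G {g} = range (\<lambda>k::nat. g [^] k)"
proof -
  have "\<exists>l::nat. g [^] k = g [^] l" for k :: int
  proof
    define N :: int where "N = 2 ^ K"
    have "g [^] N = \<one>" using pow_exponent[OF assms] int_pow_int[of G g "2 ^ K"] by (simp add: N_def)
    hence "g [^] (N * (k div N)) = \<one>" using assms by (simp flip: int_pow_pow)
    hence "g [^] k = g [^] (k mod N)"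
      using assms int_pow_mult[of g "N * (k div N)" "k mod N"] by simp
    also have "k mod N = int (nat (k mod N))" by (simp add: N_def)
    finally show "g [^] k = g [^] nat (k mod N)" by (simp only: int_pow_int)
  qed
  moreover have "\<exists>l::int. g [^] k = g [^] l" for k :: nat
    using int_pow_int[of G g k] by metis
  ultimately show ?thesis unfolding generate_pow[OF assms] by (auto simp: image_iff)
qed

lemma generate_nat_pow_subset:
  assumes "g \<in> carrier G"
  shows "generate G {g [^] (k::nat)} \<subseteq> generate G {g}"
  using assms by (auto simp: generate_eq_nat_powers nat_pow_pow)

lemma generate_odd_pow:
  assumes "g \<in> carrier G" "odd k"
  shows "generate G {g [^] (k::nat)} = generate G {g}"
proof
  obtain u where "[k * u = 1] (mod 2 ^ K)" using odd_inverse_mod_power_2[OF assms(2)] by blast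
  hence "(g [^] k) [^] u = g"
    using assms pow_cong[OF assms(1) pow_exponent[OF assms(1)], of "k * u" 1] by (simp add: nat_pow_pow)
  thus "generate G {g} \<subseteq> generate G {g [^] k}"
    using generate_nat_pow_subset[of "g [^] k" u] assms by simp
qed (rule generate_nat_pow_subset[OF assms(1)])

lemma even_pow_is_square:
  assumes "h \<in> carrier G" "even k"
  shows "h [^] (k::nat) \<notin> nonsquares G"
proof -
  have "h [^] k = h [^] (k div 2) \<otimes> h [^] (k div 2)"
    using assms by (simp add: nat_pow_mult) (metis mult_2 dvd_mult_div_cancel)
  thus ?thesis using assms by (auto simp: nonsquares_def)
qed

text \<open>
  If \<open>g = h^k\<close> then \<open>h\<close> generates the same subgroup as \<open>g\<close> for odd \<open>k\<close>, while \<open>g\<close> is a square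
  for even \<open>k\<close>. So nonsquares generate maximal cyclic subgroups. Conversely, if \<open>\<langle>h^2\<rangle> = \<langle>h\<rangle>\<close>
  then \<open>h\<close> has odd order and is trivial; the trivial subgroup is not maximal in a nontrivial
  group.
\<close>

lemma maximal_cyclic_subgroups_eq:
  assumes "carrier G \<noteq> {\<one>}"
  shows "maximal_cyclic_subgroups G = (\<lambda>g. generate G {g}) ` nonsquares G"
proof (intro equalityI subsetI)
  fix H assume H: "H \<in> maximal_cyclic_subgroups G"
  then obtain g where g: "g \<in> carrier G" "H = generate G {g}"
    by (auto simp: maximal_cyclic_subgroups_def cyclic_subgroup_iff_generate)
  have max: "generate G {h} = H" if "h \<in> carrier G" "H \<subseteq> generate G {h}" for h
    using H that unfolding maximal_cyclic_subgroups_def cyclic_subgroup_iff_generate by blast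
  have "g \<in> nonsquares G"
  proof (rule ccontr)
    assume "g \<notin> nonsquares G"
    then obtain h where h: "h \<in> carrier G" "g = h \<otimes> h" using g by (auto simp: nonsquares_def)
    have g2: "g = h [^] (2::nat)" using h by (simp add: numeral_2_eq_2)
    have "generate G {h} = H" using max[OF h(1)] generate_nat_pow_subset[OF h(1), of 2] g g2 by simp
    hence "h \<in> generate G {g}" using g generate.incl[of h "{h}" G] by simp
    then obtain k :: nat where "h = g [^] k" using g generate_eq_nat_powers by auto
    hence e: "h = h [^] (2 * k)" unfolding g2 nat_pow_pow[OF h(1)] .
    \<comment> \<open>iterating \<open>h = h^(2 k)\<close> reaches an exponent that is divisible by \<open>2^K\<close>\<close>
    have "h [^] ((2 * k) ^ i) = h" for i :: nat
    proof (induction i)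
      case (Suc i)
      have "h [^] ((2 * k) ^ Suc i) = (h [^] ((2 * k) ^ i)) [^] (2 * k)"
        by (simp only: nat_pow_pow[OF h(1)] power_Suc2)
      thus ?case unfolding Suc e[symmetric] .
    qed (use h in simp)
    hence "h = (h [^] ((2::nat) ^ K)) [^] (k ^ K)"
      by (simp only: nat_pow_pow[OF h(1)] power_mult_distrib[symmetric])
    hence "h = \<one>" using h pow_exponent by simp
    hence "H = {\<one>}" using g h generate_one by simp
    moreover obtain t where "t \<in> carrier G" "t \<noteq> \<one>" using assms by auto
    ultimately show False using max[of t] generate.incl[of t "{t}" G] generate.one[of G "{t}"] by auto
  qed
  thus "H \<in> (\<lambda>g. generate G {g}) ` nonsquares G" using g by blast
next
  fix H assume "H \<in> (\<lambda>g. generate G {g}) ` nonsquares G"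
  then obtain g where g: "g \<in> nonsquares G" "H = generate G {g}" by blast
  hence gc: "g \<in> carrier G" by (simp add: nonsquares_def)
  have "generate G {h} = H" if h: "h \<in> carrier G" "H \<subseteq> generate G {h}" for h
  proof -
    obtain k :: nat where k: "g = h [^] k"
      using h g(2) generate.incl[of g "{g}" G] generate_eq_nat_powers[OF h(1)] by auto
    hence "odd k" using even_pow_is_square[OF h(1)] g(1) by blast
    thus ?thesis using generate_odd_pow[OF h(1)] g(2) k by simp
  qed
  thus "H \<in> maximal_cyclic_subgroups G"
    unfolding maximal_cyclic_subgroups_def cyclic_subgroup_iff_generate using g(2) gc by blast
qed

lemma conj_orbit_generate:
  assumes "g \<in> carrier G"
  shows "conj_orbit G (generate G {g}) = {generate G {h \<otimes> g \<otimes> inv h} | h. h \<in> carrier G}"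
proof -
  have "h <# generate G {g} #> inv h = generate G {h \<otimes> g \<otimes> inv h}" if "h \<in> carrier G" for h
    using assms that
    by (auto simp: generate_eq_nat_powers conj_nat_pow l_coset_def r_coset_def)
  thus ?thesis unfolding orbit_def by (auto; metis)
qed

text \<open>
  If the generated subgroups are conjugate, then \<open>g'\<close> is conjugate to some power of \<open>g\<close>, and the
  exponent is odd because \<open>g'\<close> is not a square. Odd powers generate the same subgroup in a group
  of 2-power exponent.
\<close>

lemma conj_orbit_eq_iff:
  assumes "g \<in> carrier G" "g' \<in> nonsquares G"
  shows "conj_orbit G (generate G {g}) = conj_orbit G (generate G {g'}) \<longleftrightarrow> conj_odd_power G g g'"
proof
  have g': "g' \<in> carrier G" using assms(2) by (simp add: nonsquares_def)
  assume "conj_orbit G (generate G {g}) = conj_orbit G (generate G {g'})"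
  moreover have "generate G {g'} \<in> conj_orbit G (generate G {g'})"
    unfolding conj_orbit_generate[OF g'] using g' by (auto intro!: exI[of _ \<one>])
  ultimately obtain h where h: "h \<in> carrier G" "generate G {g'} = generate G {h \<otimes> g \<otimes> inv h}"
    unfolding conj_orbit_generate[OF assms(1)] by auto
  hence "g' \<in> generate G {h \<otimes> g \<otimes> inv h}" using generate.incl[of g' "{g'}" G] by simp
  then obtain u :: nat where u: "g' = (h \<otimes> g \<otimes> inv h) [^] u"
    using generate_eq_nat_powers h assms(1) by auto
  have "odd u" using even_pow_is_square[of "h \<otimes> g \<otimes> inv h" u] assms u h(1) by auto
  moreover have "inv h \<otimes> g' = g [^] u \<otimes> inv h"
    unfolding u using h assms(1) by (simp add: conj_nat_pow) (simp add: m_assoc[symmetric])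
  ultimately show "conj_odd_power G g g'" unfolding conj_odd_power_def using h(1) by blast
next
  have g': "g' \<in> carrier G" using assms(2) by (simp add: nonsquares_def)
  assume "conj_odd_power G g g'"
  then obtain h u where hu: "h \<in> carrier G" "odd (u::nat)" "h \<otimes> g' = (g [^] u) \<otimes> h"
    by (auto simp: conj_odd_power_def)
  have g'_eq: "g' = inv h \<otimes> (g [^] u) \<otimes> h"
    using hu assms(1) g' by (metis inv_closed inv_solve_left m_assoc m_closed nat_pow_closed)
  have *: "generate G {k \<otimes> g' \<otimes> inv k} = generate G {(k \<otimes> inv h) \<otimes> g \<otimes> inv (k \<otimes> inv h)}"
    if k: "k \<in> carrier G" for k
  proof -
    have "k \<otimes> g' \<otimes> inv k = (k \<otimes> inv h) \<otimes> (g [^] u) \<otimes> inv (k \<otimes> inv h)"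
      unfolding g'_eq using k hu assms(1) by (simp add: inv_mult_group m_assoc)
    also have "\<dots> = ((k \<otimes> inv h) \<otimes> g \<otimes> inv (k \<otimes> inv h)) [^] u"
      using k hu assms(1) by (simp add: conj_nat_pow)
    finally show ?thesis using generate_odd_pow hu k assms(1) by simp
  qed
  show "conj_orbit G (generate G {g}) = conj_orbit G (generate G {g'})"
    unfolding conj_orbit_generate[OF assms(1)] conj_orbit_generate[OF g']
  proof (intro equalityI subsetI; elim CollectE exE conjE)
    fix H k assume "H = generate G {k \<otimes> g \<otimes> inv k}" "k \<in> carrier G"
    moreover have "(k \<otimes> h) \<otimes> inv h = k" using calculation hu by (simp add: m_assoc)
    ultimately show "H \<in> {generate G {h \<otimes> g' \<otimes> inv h} |h. h \<in> carrier G}"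
      using *[of "k \<otimes> h"] hu by auto
  next
    fix H k assume "H = generate G {k \<otimes> g' \<otimes> inv k}" "k \<in> carrier G"
    thus "H \<in> {generate G {h \<otimes> g \<otimes> inv h} |h. h \<in> carrier G}"
      using *[of k] hu by auto
  qed
qed

text \<open>
  Two nonsquares generate conjugate subgroups exactly if one is conjugate to an odd power of the
  other, so a transversal of this relation counts the conjugacy classes of maximal cyclic
  subgroups.
\<close>

lemma eta_eq_card_representatives:
  assumes "R \<noteq> {}" "R \<subseteq> nonsquares G"
    and cover: "\<And>g. g \<in> nonsquares G \<Longrightarrow> \<exists>g'\<in>R. conj_odd_power G g g'"
    and distinct: "\<And>g g'. g \<in> R \<Longrightarrow> g' \<in> R \<Longrightarrow> conj_odd_power G g g' \<Longrightarrow> g = g'"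
  shows "eta G = card R"
proof -
  let ?orb = "\<lambda>g. conj_orbit G (generate G {g})"
  have c: "g \<in> carrier G" if "g \<in> nonsquares G" for g using that by (simp add: nonsquares_def)
  obtain t where "t \<in> nonsquares G" using assms by blast
  hence "t \<in> carrier G" "t \<noteq> \<one>" by (auto simp: nonsquares_def)
  hence nt: "carrier G \<noteq> {\<one>}" by blast
  have "orbits G (maximal_cyclic_subgroups G) (\<lambda>g H. g <# H #> (inv g)) = ?orb ` nonsquares G"
    unfolding orbits_def maximal_cyclic_subgroups_eq[OF nt] by blast
  also have "\<dots> = ?orb ` R"
  proof (intro equalityI subsetI)
    fix X assume "X \<in> ?orb ` nonsquares G"
    then obtain g where g: "g \<in> nonsquares G" "X = ?orb g" by blast
    then obtain g' where "g' \<in> R" "conj_odd_power G g g'" using cover by blast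
    moreover have "?orb g = ?orb g'" using conj_orbit_eq_iff[of g g'] calculation g c assms(2) by blast
    ultimately show "X \<in> ?orb ` R" using g by blast
  qed (use assms(2) in blast)
  finally have "eta G = card (?orb ` R)" unfolding eta_def by simp
  also have "inj_on ?orb R"
  proof (rule inj_onI)
    fix g g' assume "g \<in> R" "g' \<in> R" "?orb g = ?orb g'"
    thus "g = g'" using conj_orbit_eq_iff[of g g'] c assms(2) distinct by blast
  qed
  hence "card (?orb ` R) = card R" by (rule card_image)
  finally show ?thesis .
qed

end

lemma (in group) conj_odd_power_trans:
  assumes "conj_odd_power G a1 a2" "conj_odd_power G a2 a3"
    and c: "a1 \<in> carrier G" "a2 \<in> carrier G" "a3 \<in> carrier G"
  shows "conj_odd_power G a1 a3"
proof -
  obtain h u where h: "h \<in> carrier G" "odd (u::nat)" "h \<otimes> a2 = (a1 [^] u) \<otimes> h"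
    using assms(1) by (auto simp: conj_odd_power_def)
  obtain k v where k: "k \<in> carrier G" "odd (v::nat)" "k \<otimes> a3 = (a2 [^] v) \<otimes> k"
    using assms(2) by (auto simp: conj_odd_power_def)
  have p: "h \<otimes> (a2 [^] n) = (a1 [^] (u * n)) \<otimes> h" for n :: nat
  proof (induction n)
    case (Suc n)
    have "h \<otimes> (a2 [^] Suc n) = (h \<otimes> (a2 [^] n)) \<otimes> a2" using h c by (simp add: m_assoc)
    also have "\<dots> = (a1 [^] (u * n)) \<otimes> (h \<otimes> a2)" unfolding Suc using h c by (simp add: m_assoc)
    also have "\<dots> = (a1 [^] (u * Suc n)) \<otimes> h"
      unfolding h(3) using h c by (simp add: m_assoc[symmetric] nat_pow_mult add.commute)
    finally show ?case .
  qed (use h in simp)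
  have "(h \<otimes> k) \<otimes> a3 = h \<otimes> (a2 [^] v) \<otimes> k" using h k c by (simp add: m_assoc)
  also have "\<dots> = (a1 [^] (u * v)) \<otimes> (h \<otimes> k)" unfolding p using h k c by (simp add: m_assoc)
  finally show ?thesis using h k unfolding conj_odd_power_def
    by (intro bexI[of _ "h \<otimes> k"] exI[of _ "u * v"]) auto
qed


section \<open>Calculating with metacyclic relations\<close>

locale metacyclic_relations = group G for G (structure) +
  fixes x y :: 'a and \<alpha> \<beta> \<gamma> r :: nat
  assumes x_closed [simp, intro]: "x \<in> carrier G" and y_closed [simp, intro]: "y \<in> carrier G"
    and x_pow: "x [^] (2 ^ \<alpha> :: nat) = \<one>"
    and y_pow: "y [^] (2 ^ \<beta> :: nat) = x [^] (2 ^ \<gamma> :: nat)"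
    and x_y: "x \<otimes> y = y \<otimes> x [^] r"
begin

definition elt :: "nat \<Rightarrow> nat \<Rightarrow> 'a" where
  "elt j i = y [^] j \<otimes> x [^] i"

lemma elt_closed [simp, intro]: "elt j i \<in> carrier G"
  by (simp add: elt_def)

lemma x_pow_y: "x [^] i \<otimes> y = y \<otimes> x [^] (i * r)"
proof (induction i)
  case (Suc i)
  have "x [^] Suc i \<otimes> y = x [^] i \<otimes> y \<otimes> x [^] r"
    using x_y by (simp add: m_assoc)
  also have "\<dots> = y \<otimes> x [^] (Suc i * r)"
    unfolding Suc by (simp add: m_assoc nat_pow_mult add.commute)
  finally show ?case .
qed simp

lemma x_pow_y_pow: "x [^] i \<otimes> y [^] j = y [^] j \<otimes> x [^] (i * r ^ j)"
proof (induction j)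
  case (Suc j)
  have "x [^] i \<otimes> y [^] Suc j = (x [^] i \<otimes> y [^] j) \<otimes> y" by (simp add: m_assoc)
  also have "\<dots> = y [^] j \<otimes> (x [^] (i * r ^ j) \<otimes> y)" unfolding Suc by (simp add: m_assoc)
  also have "\<dots> = y [^] Suc j \<otimes> x [^] (i * r ^ Suc j)"
    unfolding x_pow_y by (simp add: m_assoc mult.left_commute mult.commute)
  finally show ?case .
qed simp

lemma elt_mult: "elt j i \<otimes> elt k l = elt (j + k) (i * r ^ k + l)"
proof -
  have "elt j i \<otimes> elt k l = y [^] j \<otimes> (x [^] i \<otimes> y [^] k) \<otimes> x [^] l"
    by (simp add: elt_def m_assoc)
  also have "\<dots> = (y [^] j \<otimes> y [^] k) \<otimes> (x [^] (i * r ^ k) \<otimes> x [^] l)"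
    unfolding x_pow_y_pow by (simp add: m_assoc)
  finally show ?thesis by (simp add: elt_def nat_pow_mult)
qed

lemma elt_cong: "[i = i'] (mod 2 ^ \<alpha>) \<Longrightarrow> elt j i = elt j i'"
  unfolding elt_def using pow_cong[OF x_closed x_pow] by metis

lemma elt_0_0: "elt 0 0 = \<one>"
  by (simp add: elt_def)

lemma y_pow_mult: "y [^] (2 ^ \<beta> * t :: nat) = x [^] (2 ^ \<gamma> * t)"
  using y_pow by (simp flip: nat_pow_pow)

text \<open>
  Changing \<open>j\<close> by a multiple of \<open>2^\<beta>\<close> multiplies by a power of \<open>y^(2^\<beta>) = x^(2^\<gamma>)\<close>, which is
  absorbed in the exponent of \<open>x\<close>.
\<close>

lemma elt_change_y_exponent:
  assumes "[j = j'] (mod 2 ^ \<beta>)"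
  shows "\<exists>i'. [i' = i] (mod 2 ^ \<gamma>) \<and> elt j i = elt j' i'"
proof -
  obtain t1 t2 where t: "j' + t1 * 2 ^ \<beta> = j + t2 * 2 ^ \<beta>" using assms by (auto simp: cong_iff_lin_nat)
  \<comment> \<open>the factor \<open>2^\<alpha> - 1\<close> stands for \<open>-1\<close>, so that exponents remain natural numbers\<close>
  define s where "s = 2 ^ \<gamma> * t1 + 2 ^ \<gamma> * (t2 * (2 ^ \<alpha> - 1))"
  have "2 ^ \<gamma> * t2 + 2 ^ \<gamma> * (t2 * (2 ^ \<alpha> - 1)) = 2 ^ \<gamma> * (t2 * (1 + (2 ^ \<alpha> - 1)))"
    by (simp only: distrib_left mult_1_right)
  also have "\<dots> = 2 ^ \<alpha> * (2 ^ \<gamma> * t2)" by simp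
  finally have "x [^] (2 ^ \<gamma> * t2 + 2 ^ \<gamma> * (t2 * (2 ^ \<alpha> - 1))) = x [^] (0::nat)"
    by (intro pow_cong[OF x_closed x_pow]) (simp add: cong_def)
  hence 1: "x [^] (2 ^ \<gamma> * t2) \<otimes> x [^] (2 ^ \<gamma> * (t2 * (2 ^ \<alpha> - 1))) = \<one>"
    by (simp add: nat_pow_mult)
  have "y [^] j = y [^] j \<otimes> y [^] (2 ^ \<beta> * t2) \<otimes> x [^] (2 ^ \<gamma> * (t2 * (2 ^ \<alpha> - 1)))"
    unfolding y_pow_mult using 1 by (simp add: m_assoc)
  also have "y [^] j \<otimes> y [^] (2 ^ \<beta> * t2) = y [^] (j + t2 * 2 ^ \<beta>)"
    by (simp add: nat_pow_mult mult.commute)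
  also have "\<dots> = y [^] (j' + t1 * 2 ^ \<beta>)" by (simp only: t)
  also have "\<dots> = y [^] j' \<otimes> y [^] (2 ^ \<beta> * t1)" by (simp add: nat_pow_mult mult.commute)
  also have "\<dots> = y [^] j' \<otimes> x [^] (2 ^ \<gamma> * t1)" by (simp only: y_pow_mult)
  finally have "y [^] j = y [^] j' \<otimes> x [^] s"
    by (simp add: s_def nat_pow_mult m_assoc)
  hence "elt j i = elt j' (s + i)" by (simp add: elt_def nat_pow_mult m_assoc)
  moreover have "[s + i = i] (mod 2 ^ \<gamma>)" by (simp add: s_def cong_def flip: distrib_left)
  ultimately show ?thesis by blast
qed

text \<open>
  The exponent of \<open>x\<close> in the power is \<open>i (1 + r^j + r^(2 j) + \<dots>)\<close> with \<open>u\<close> summands; modulo an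
  \<open>N\<close> for which \<open>r^j\<close> is \<open>1\<close> it is \<open>i u\<close>.
\<close>

lemma elt_pow:
  assumes "odd r" "N = 2 \<or> even j \<and> [r ^ 2 = 1] (mod N)"
  shows "\<exists>i'. elt j i [^] (u::nat) = elt (j * u) i' \<and> [i' = i * u] (mod N)"
proof (induction u)
  case 0
  show ?case by (intro exI[of _ 0]) (simp add: elt_0_0)
next
  case (Suc u)
  then obtain i' where i': "elt j i [^] u = elt (j * u) i'" "[i' = i * u] (mod N)" by blast
  have "[r ^ j = 1] (mod N)"
  proof (cases "N = 2")
    case True
    thus ?thesis using assms(1) by (simp add: cong_2_iff)
  next
    case False
    hence "r ^ j = (r ^ 2) ^ (j div 2)" using assms(2) by (simp flip: power_mult)
    thus ?thesis using cong_pow[of "r ^ 2" 1 N "j div 2"] False assms(2) by simp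
  qed
  hence "[i' * r ^ j + i = (i * u) * 1 + i] (mod N)" by (intro cong_add cong_mult i') auto
  moreover have "elt j i [^] Suc u = elt (j * Suc u) (i' * r ^ j + i)"
    by (simp add: i' elt_mult add.commute)
  ultimately show ?case by (intro exI[of _ "i' * r ^ j + i"]) (simp add: add.commute)
qed

text \<open>
  The power with exponent \<open>2^\<beta>\<close> has a multiple of \<open>2^\<beta>\<close> as exponent of \<open>y\<close>, hence lies in \<open>\<langle>x\<rangle>\<close>.
\<close>

lemma elt_pow_exponent: "elt j i [^] (2 ^ (\<beta> + \<alpha>) :: nat) = \<one>"
proof -
  have "\<exists>l. elt j i [^] (u::nat) = elt (j * u) l" for u
  proof (induction u)
    case (Suc u)
    thus ?case by (auto simp: elt_mult add.commute)
  qed (auto intro: exI[of _ 0] simp: elt_0_0)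
  then obtain l where l: "elt j i [^] (2 ^ \<beta> :: nat) = elt (j * 2 ^ \<beta>) l" by blast
  obtain l' where "elt (j * 2 ^ \<beta>) l = elt 0 l'"
    using elt_change_y_exponent[of "j * 2 ^ \<beta>" 0 l] by (auto simp: cong_def)
  hence "elt j i [^] (2 ^ (\<beta> + \<alpha>) :: nat) = (x [^] l') [^] (2 ^ \<alpha> :: nat)"
    unfolding power_add nat_pow_pow[OF elt_closed, symmetric] l by (simp add: elt_def)
  also have "\<dots> = (x [^] (2 ^ \<alpha> :: nat)) [^] l'" by (simp only: nat_pow_pow x_closed mult.commute)
  finally show ?thesis by (simp add: x_pow)
qed

end


section \<open>Squares and conjugacy in the negative type\<close>

text \<open>
  The last assumption says that the exponents of an element are determined modulo \<open>2^\<beta>\<close> and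
  \<open>2^(m + 1)\<close>; in other words, the quotient by \<open>\<langle>x^(2^(m + 1))\<rangle>\<close> is as large as possible. The
  classes to be counted can be told apart in this quotient.
\<close>

locale negative_metacyclic = metacyclic_relations G x y \<alpha> \<beta> \<gamma> r
    for G (structure) and x y :: 'a and \<alpha> \<beta> \<gamma> r :: nat +
  fixes m b :: nat
  assumes r_def: "r = 2 ^ m - 1" and m_ge: "m \<ge> 2" and b_ge: "b \<ge> 1" and \<beta>_def: "\<beta> = Suc b"
    and \<gamma>_ge: "\<gamma> \<ge> Suc m"
    and carrier_elt: "g \<in> carrier G \<Longrightarrow> \<exists>j i. g = elt j i"
    and elt_eq_imp: "elt j i = elt j' i' \<Longrightarrow> [j = j'] (mod 2 ^ \<beta>) \<and> [i = i'] (mod 2 ^ Suc m)"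
begin

sublocale two_power_exponent_group G "\<beta> + \<alpha>"
  by unfold_locales (use carrier_elt elt_pow_exponent in blast)

lemma r_mod_4: "r mod 4 = 3"
proof -
  have "(2::nat) ^ m = 4 * 2 ^ (m - 2)" using m_ge by (rule two_power_eq_4_times)
  moreover obtain t where "(2::nat) ^ (m - 2) = Suc t" using not0_implies_Suc[of "2 ^ (m - 2)"] by auto
  ultimately have "r = 4 * t + 3" by (simp add: r_def)
  thus ?thesis by simp
qed

lemma odd_r: "odd r"
  using r_mod_4 by presburger

lemma r_plus_1: "r + 1 = 2 ^ m"
  by (simp add: r_def)

text \<open>
  This exact valuation is what makes conjugation reach all exponents of \<open>x\<close> in a residue class
  modulo \<open>2^(m + 1)\<close>: \<open>r^2\<close> generates the units congruent to \<open>1\<close> modulo \<open>2^(m + 1)\<close>.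
\<close>

lemma r_square: "\<exists>c. odd c \<and> r ^ 2 = 1 + 2 ^ Suc m * c"
proof -
  obtain t where t: "m = Suc (Suc t)" using m_ge by (metis add_2_eq_Suc le_Suc_ex)
  obtain c :: nat where c0: "2 ^ Suc t = Suc c" using not0_implies_Suc[of "2 ^ Suc t"] by auto
  have "odd c" using arg_cong[OF c0, of even] by simp
  moreover have "(2::nat) ^ m = 2 * c + 2" unfolding t power_Suc[of 2 "Suc t"] c0 by simp
  ultimately have c: "(2::nat) ^ m = 2 * c + 2" "odd c" by simp_all
  have "r = 2 * c + 1" using c r_def by simp
  moreover have "(2::nat) ^ Suc m = 4 * c + 4" using c by simp
  ultimately have "r ^ 2 = 1 + 2 ^ Suc m * c" by (simp add: power2_eq_square algebra_simps)
  thus ?thesis using c(2) by blast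
qed

lemma r_square_cong: "[r ^ 2 = 1] (mod 2 ^ Suc m)"
proof -
  obtain c where "r ^ 2 = 1 + 2 ^ Suc m * c" using r_square by blast
  thus ?thesis unfolding cong_def by (metis mod_mult_self2)
qed

lemma r_pow_cong: "[r ^ k = (if even k then 1 else r)] (mod 2 ^ Suc m)"
proof -
  have *: "[(r ^ 2) ^ (k div 2) = 1] (mod 2 ^ Suc m)"
    using cong_pow[OF r_square_cong, of "k div 2"] by simp
  have "r ^ k = r ^ (2 * (k div 2) + k mod 2)" by simp
  also have "\<dots> = (r ^ 2) ^ (k div 2) * r ^ (k mod 2)" by (simp only: power_add power_mult)
  also have "[\<dots> = 1 * r ^ (k mod 2)] (mod 2 ^ Suc m)" using * by (intro cong_mult cong_refl)
  finally show ?thesis by (simp add: mod2_eq_if split: if_splits)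
qed

lemma cong_imp_cong_4:
  "[j = j'] (mod 2 ^ \<beta>) \<Longrightarrow> [j = j'] (mod 4)" for j j' :: nat
proof (erule cong_dvd_modulus_nat)
  show "4 dvd (2::nat) ^ \<beta>" using two_power_eq_4_times[of \<beta>] b_ge \<beta>_def by simp
qed

text \<open>
  The square of \<open>y^k x^l\<close> is \<open>y^(2 k) x^(l (r^k + 1))\<close>. The number \<open>r^k + 1\<close> is twice an odd
  number for even \<open>k\<close>, and it is an odd multiple of \<open>2^m = r + 1\<close> for odd \<open>k\<close>, so modulo \<open>2^\<alpha>\<close>
  the product \<open>l (r^k + 1)\<close> runs through all multiples of \<open>2\<close> and of \<open>2^m\<close>, respectively.
\<close>

lemma nonsquare_elt_iff:
  "elt j i \<in> nonsquares G \<longleftrightarrow> \<not> (even j \<and> even i \<and> (j mod 4 = 2 \<longrightarrow> 2 ^ m dvd i))"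
proof -
  have "(\<exists>h\<in>carrier G. elt j i = h \<otimes> h) \<longleftrightarrow> even j \<and> even i \<and> (j mod 4 = 2 \<longrightarrow> 2 ^ m dvd i)"
    (is "?L \<longleftrightarrow> ?R")
  proof
    assume ?L
    then obtain k l where "elt j i = elt k l \<otimes> elt k l" using carrier_elt by metis
    hence e: "[j = k + k] (mod 2 ^ \<beta>)" "[i = l * r ^ k + l] (mod 2 ^ Suc m)"
      using elt_eq_imp by (simp_all only: elt_mult)
    have j4: "j mod 4 = (k + k) mod 4" using cong_imp_cong_4[OF e(1)] by (simp add: cong_def)
    hence "even j" by presburger
    moreover have "even i" using cong_two_power_Suc_imp_parity[OF e(2)] odd_r by simp
    moreover have "2 ^ m dvd i" if "j mod 4 = 2"
    proof -
      have "odd k" using j4 that by presburger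
      then obtain c where c: "r ^ k + 1 = 2 ^ m * c" using odd_power_plus_one[OF odd_r] r_plus_1 by metis
      have "l * r ^ k + l = l * (r ^ k + 1)" by (simp only: distrib_left mult_1_right)
      also have "\<dots> = 2 ^ m * (l * c)" unfolding c by simp
      finally have "2 ^ m dvd l * r ^ k + l" by simp
      moreover have "[i = l * r ^ k + l] (mod 2 ^ m)" using e(2) by (rule cong_dvd_modulus_nat) simp
      ultimately show ?thesis by (simp only: cong_dvd_iff)
    qed
    ultimately show ?R by blast
  next
    assume R: ?R
    define k where "k = j div 2"
    have j: "j = k + k" using R by (simp add: k_def flip: mult_2)
    have "\<exists>s c. odd c \<and> r ^ k + 1 = 2 ^ s * c \<and> [i = 0] (mod 2 ^ s)"
    proof (cases "even k")
      case True
      have "[r ^ k = 1] (mod 4)"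
      proof -
        have "[r ^ k = 1] (mod 2 ^ Suc m)" using r_pow_cong[of k] True by simp
        moreover have "4 dvd (2::nat) ^ Suc m" using two_power_eq_4_times[of "Suc m"] m_ge by simp
        ultimately show ?thesis by (rule cong_dvd_modulus_nat)
      qed
      hence "(r ^ k) mod 4 = 1" by (simp add: cong_def)
      moreover have "odd ((q + 1) div 2) \<and> q + 1 = 2 ^ 1 * ((q + 1) div 2)" if "q mod 4 = 1" for q :: nat
        using that by (auto, presburger+)
      ultimately have "odd ((r ^ k + 1) div 2)" "r ^ k + 1 = 2 ^ 1 * ((r ^ k + 1) div 2)" by blast+
      moreover have "[i = 0] (mod 2 ^ 1)" using R by (simp add: cong_def)
      ultimately show ?thesis by blast
    next
      case False
      then obtain c where "odd c" "r ^ k + 1 = 2 ^ m * c"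
        using odd_power_plus_one[OF odd_r] r_plus_1 by metis
      moreover have "j mod 4 = 2" using False j by presburger
      hence "[i = 0] (mod 2 ^ m)" using R by (simp add: cong_0_iff)
      ultimately show ?thesis by blast
    qed
    then obtain s c where sc: "odd c" "r ^ k + 1 = 2 ^ s * c" "[i = 0] (mod 2 ^ s)" by blast
    obtain l where "[i = l * (2 ^ s * c) + 0] (mod 2 ^ \<alpha>)"
      using solve_linear_cong_power_2[OF sc(1,3)] by blast
    hence "[i = l * r ^ k + l] (mod 2 ^ \<alpha>)" by (simp flip: sc(2) add: add.commute)
    hence "elt j i = elt k l \<otimes> elt k l" unfolding j elt_mult by (rule elt_cong)
    thus ?L by blast
  qed
  thus ?thesis unfolding nonsquares_def using elt_closed by blast
qed

text \<open>
  Taking the odd power multiplies the exponents by \<open>u\<close>, at least modulo \<open>2^\<beta>\<close> and \<open>2\<close>.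
  Conjugation by \<open>y^k x^l\<close> does not change the exponent of \<open>y\<close>. If this exponent is even, then
  \<open>x\<close> commutes with the element up to a power of \<open>x^(2^(m + 1))\<close>, so that modulo \<open>2^(m + 1)\<close> the
  exponent of \<open>x\<close> is only multiplied by \<open>r^k\<close>.
\<close>

lemma conj_odd_power_elt_imp:
  assumes "conj_odd_power G (elt j i) (elt j' i')"
  shows "\<exists>u k. odd u \<and> [j' = j * u] (mod 2 ^ \<beta>) \<and> (even i' \<longleftrightarrow> even i) \<and>
    (even j \<longrightarrow> [i' = i * u * r ^ k] (mod 2 ^ Suc m))"
proof -
  obtain h u where h: "h \<in> carrier G" "odd (u::nat)" "h \<otimes> elt j' i' = (elt j i [^] u) \<otimes> h"
    using assms by (auto simp: conj_odd_power_def)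
  obtain k l where kl: "h = elt k l" using carrier_elt h(1) by blast
  have *: "\<exists>i1. [k + j' = j * u + k] (mod 2 ^ \<beta>) \<and> [l * r ^ j' + i' = i1 * r ^ k + l] (mod 2 ^ Suc m) \<and>
    [i1 = i * u] (mod N)" if N: "N = 2 \<or> even j \<and> [r ^ 2 = 1] (mod N)" for N
  proof -
    obtain i1 where i1: "elt j i [^] u = elt (j * u) i1" "[i1 = i * u] (mod N)"
      using elt_pow[OF odd_r N] by blast
    have "elt (k + j') (l * r ^ j' + i') = elt (j * u + k) (i1 * r ^ k + l)"
      using h(3) unfolding kl i1(1) elt_mult .
    thus ?thesis using elt_eq_imp i1(2) by blast
  qed
  obtain i1 where i1: "[k + j' = j * u + k] (mod 2 ^ \<beta>)"
    "[l * r ^ j' + i' = i1 * r ^ k + l] (mod 2 ^ Suc m)" "[i1 = i * u] (mod 2)"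
    using *[of 2] by blast
  have j: "[j' = j * u] (mod 2 ^ \<beta>)"
    using i1(1) unfolding add.commute[of "j * u" k] by (simp only: cong_add_lcancel_nat)
  have p: "even i' \<longleftrightarrow> even i"
    using cong_two_power_Suc_imp_parity[OF i1(2)] i1(3) h(2) odd_r by (auto simp: cong_2_iff)
  have "[i' = i * u * r ^ k] (mod 2 ^ Suc m)" if ej: "even j"
  proof -
    obtain i2 where i2: "[l * r ^ j' + i' = i2 * r ^ k + l] (mod 2 ^ Suc m)" "[i2 = i * u] (mod 2 ^ Suc m)"
      using *[of "2 ^ Suc m"] ej r_square_cong by blast
    have "even j'" using cong_two_power_Suc_imp_parity[OF j[unfolded \<beta>_def]] ej by simp
    hence "[r ^ j' = 1] (mod 2 ^ Suc m)" using r_pow_cong[of j'] by simp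
    hence "[l * 1 + i' = l * r ^ j' + i'] (mod 2 ^ Suc m)"
      by (intro cong_add cong_mult cong_refl) (rule cong_sym)
    also note i2(1)
    also have "[i2 * r ^ k + l = i * u * r ^ k + l] (mod 2 ^ Suc m)"
      by (intro cong_add cong_mult cong_refl i2(2))
    finally have "[l + i' = l + i * u * r ^ k] (mod 2 ^ Suc m)" by (simp add: add.commute)
    thus ?thesis by (simp only: cong_add_lcancel_nat)
  qed
  thus ?thesis using h(2) j p by blast
qed

text \<open>
  Conjugation by \<open>x^l\<close> changes the exponent of \<open>x\<close> by a multiple of \<open>r^j - 1\<close>, and every
  multiple occurs.
\<close>

lemma conj_elt_by_x:
  assumes "r ^ j = 1 + 2 ^ s * c" "odd c" "[i = i'] (mod 2 ^ s)"
  shows "\<exists>h\<in>carrier G. h \<otimes> elt j i' = elt j i \<otimes> h"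
proof -
  obtain l where "[i = l * (2 ^ s * c) + i'] (mod 2 ^ \<alpha>)"
    using solve_linear_cong_power_2[OF assms(2,3)] by blast
  hence "[i + l = l * (2 ^ s * c) + i' + l] (mod 2 ^ \<alpha>)" by (intro cong_add cong_refl)
  also have "l * (2 ^ s * c) + i' + l = l * r ^ j + i'" by (simp add: assms(1) algebra_simps)
  finally have "[l * r ^ j + i' = i + l] (mod 2 ^ \<alpha>)" by (rule cong_sym)
  hence "elt 0 l \<otimes> elt j i' = elt j i \<otimes> elt 0 l" unfolding elt_mult by (auto intro: elt_cong)
  thus ?thesis by blast
qed

text \<open>
  Conjugation by \<open>y^(2 k)\<close> multiplies the exponent of \<open>x\<close> by \<open>(r^2)^k\<close>, which can be any unit
  congruent to \<open>1\<close> modulo \<open>2^(m + 1)\<close>.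
\<close>

lemma conj_elt_by_y:
  assumes "odd i" "[i = i'] (mod 2 ^ Suc m)"
  shows "\<exists>h\<in>carrier G. h \<otimes> elt j i' = elt j i \<otimes> h"
proof -
  obtain w where w: "[i * w = 1] (mod 2 ^ (\<alpha> + Suc m))" using odd_inverse_mod_power_2[OF assms(1)] by blast
  obtain c where c: "odd c" "r ^ 2 = 1 + 2 ^ Suc m * c" using r_square by blast
  have w2: "[i * w = 1] (mod 2 ^ Suc m)"
    by (rule cong_dvd_modulus_nat[OF w]) (simp add: power_add)
  have "[i' * w = i * w] (mod 2 ^ Suc m)" using cong_sym[OF assms(2)] by (intro cong_mult cong_refl)
  hence "[i' * w = 1] (mod 2 ^ Suc m)" using w2 by (rule cong_trans)
  then obtain k where k: "[(r ^ 2) ^ k = i' * w] (mod 2 ^ \<alpha>)"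
    using power_of_one_plus_surj[OF c(1), of "Suc m" "i' * w" \<alpha>] m_ge unfolding c(2) by auto
  have "[i * r ^ (2 * k) = i * (i' * w)] (mod 2 ^ \<alpha>)"
    unfolding power_mult using k by (intro cong_mult cong_refl)
  also have "i * (i' * w) = i' * (i * w)" by simp
  also have "[i' * (i * w) = i' * 1] (mod 2 ^ \<alpha>)"
    by (intro cong_mult cong_refl cong_dvd_modulus_nat[OF w]) (simp add: power_add)
  finally have "[i' = i * r ^ (2 * k)] (mod 2 ^ \<alpha>)" by (simp add: cong_sym_eq)
  hence "elt (2 * k) 0 \<otimes> elt j i' = elt j i \<otimes> elt (2 * k) 0"
    unfolding elt_mult by (simp add: add.commute elt_cong)
  thus ?thesis by blast
qed

text \<open>
  For an even exponent of \<open>y\<close> the necessary conditions of \<open>conj_odd_power_elt_imp\<close> are also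
  sufficient, provided that conjugation reaches every exponent of \<open>x\<close> in its residue class
  modulo \<open>2^(m + 1)\<close>: for odd \<open>i\<close> conjugation by powers of \<open>y\<close> does this, and for \<open>j\<close> congruent
  to \<open>2\<close> modulo \<open>4\<close> conjugation by powers of \<open>x\<close>, because then \<open>r^j - 1\<close> is \<open>2^(m + 1)\<close> times an
  odd number.
\<close>

lemma conj_odd_power_eltI:
  assumes "even j" "odd i \<or> j mod 4 = 2" "odd u" "[j' = j * u] (mod 2 ^ \<beta>)"
    "[i' = i * u * r ^ e] (mod 2 ^ Suc m)"
  shows "conj_odd_power G (elt j i) (elt j' i')"
proof -
  have step: "conj_odd_power G (elt j i) (elt j (i * r ^ e))"
    unfolding conj_odd_power_def
    by (intro bexI[of _ "elt e 0"] exI[of _ 1]) (simp_all add: elt_mult add.commute)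
  obtain i1 where i1: "elt j (i * r ^ e) [^] u = elt (j * u) i1" "[i1 = i * r ^ e * u] (mod 2 ^ Suc m)"
    using elt_pow[OF odd_r, of "2 ^ Suc m" j] r_square_cong assms(1) by blast
  obtain i2 where i2: "[i2 = i'] (mod 2 ^ \<gamma>)" "elt j' i' = elt (j * u) i2"
    using elt_change_y_exponent[OF assms(4)] by blast
  have "[i2 = i'] (mod 2 ^ Suc m)" using i2(1) \<gamma>_ge by (meson cong_dvd_modulus_nat le_imp_power_dvd)
  also note assms(5)
  also have "i * u * r ^ e = i * r ^ e * u" by simp
  also note cong_sym[OF i1(2)]
  finally have i12: "[i1 = i2] (mod 2 ^ Suc m)" by (rule cong_sym)
  have "\<exists>h\<in>carrier G. h \<otimes> elt (j * u) i2 = elt (j * u) i1 \<otimes> h"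
  proof (cases "odd i")
    case True
    have "odd i1" using cong_two_power_Suc_imp_parity[OF i1(2)] True odd_r assms(3) by simp
    thus ?thesis using i12 by (rule conj_elt_by_y)
  next
    case False
    have j: "odd (j div 2)" "j * u = 2 * (j div 2 * u)"
      using False assms(1,2) by presburger (use assms(1) in \<open>simp flip: mult.assoc\<close>)
    obtain c where c: "odd c" "r ^ 2 = 1 + 2 ^ Suc m * c" using r_square by blast
    have "odd (r ^ 2)" using odd_r by simp
    then obtain d where d: "(r ^ 2) ^ (j div 2 * u) = 1 + (r ^ 2 - 1) * d" "odd d"
      using odd_power_eq_one_plus[of "r ^ 2" "j div 2 * u"] j(1) assms(3) by auto
    have "r ^ (j * u) = (r ^ 2) ^ (j div 2 * u)" unfolding j(2) power_mult ..
    also have "\<dots> = 1 + 2 ^ Suc m * (c * d)" unfolding d(1) using c(2) by simp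
    finally have "r ^ (j * u) = 1 + 2 ^ Suc m * (c * d)" .
    thus ?thesis by (rule conj_elt_by_x[OF _ _ i12]) (use c(1) d(2) in simp)
  qed
  then obtain h where "h \<in> carrier G" "h \<otimes> elt j' i' = (elt j (i * r ^ e) [^] u) \<otimes> h"
    unfolding i2(2) i1(1) by blast
  hence "conj_odd_power G (elt j (i * r ^ e)) (elt j' i')"
    unfolding conj_odd_power_def using assms(3) by blast
  with step show ?thesis by (rule conj_odd_power_trans) auto
qed

text \<open>
  An odd power makes the exponent of \<open>y\<close> equal to \<open>1\<close>, and \<open>r - 1\<close> is only twice an odd number,
  so that conjugation by powers of \<open>x\<close> leaves just the parity of the exponent of \<open>x\<close>.
\<close>

lemma conj_odd_power_elt_odd:
  assumes "odd j"
  shows "conj_odd_power G (elt j i) (elt 1 (i mod 2))"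
proof -
  obtain u where u: "odd u" "[j * u = 1] (mod 2 ^ \<beta>)" using odd_inverse_mod_power_2[OF assms] by blast
  obtain i1 where i1: "elt j i [^] u = elt (j * u) i1" "[i1 = i * u] (mod 2)"
    using elt_pow[OF odd_r, of 2 j] by blast
  obtain i2 where i2: "[i2 = i1] (mod 2 ^ \<gamma>)" "elt (j * u) i1 = elt 1 i2"
    using elt_change_y_exponent[OF u(2)] by blast
  have "[i2 = i1] (mod 2)" using i2(1) \<gamma>_ge by (elim cong_dvd_modulus_nat) simp
  hence "[i2 = i mod 2] (mod 2 ^ 1)" using i1(2) u(1) by (auto simp: cong_2_iff)
  moreover have "r = 1 + 2 * (r div 2)" "odd (r div 2)" using r_mod_4 by presburger+
  ultimately obtain h where "h \<in> carrier G" "h \<otimes> elt 1 (i mod 2) = elt 1 i2 \<otimes> h"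
    using conj_elt_by_x[of 1 1 "r div 2" i2 "i mod 2"] by auto
  moreover from this have "h \<otimes> elt 1 (i mod 2) = (elt j i [^] u) \<otimes> h" unfolding i1(1) i2(2) by blast
  ultimately show ?thesis unfolding conj_odd_power_def using u(1) by blast
qed


section \<open>A transversal for the nonsquares\<close>

text \<open>
  Up to conjugation and odd powers, nonsquares with odd exponent of \<open>y\<close> reduce to \<open>y\<close> and \<open>y x\<close>.
  If the exponent of \<open>y\<close> is even and that of \<open>x\<close> is odd, the latter is normalised to \<open>1\<close>; the
  odd powers \<open>u\<close> that are still available satisfy \<open>u r^e = 1\<close> modulo \<open>2^(m + 1)\<close> and act on half
  the exponent of \<open>y\<close> modulo \<open>2^b\<close>. If the exponent of \<open>x\<close> is even as well, the exponent of \<open>y\<close>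
  is normalised to \<open>2\<close>; what is left are the odd powers \<open>u = 1\<close> modulo \<open>2^b\<close> and the
  multiplication by \<open>r\<close> coming from conjugation by \<open>y\<close>, acting on the exponent of \<open>x\<close> modulo
  \<open>2^(m + 1)\<close>. Here the additive orders \<open>1\<close> and \<open>2\<close> are absent, because \<open>y^2\<close> and \<open>y^2 x^(2^m)\<close>
  are the squares of \<open>y\<close> and of \<open>y x\<close>, and the order \<open>2^(m + 1)\<close> is absent, because it would
  make the exponent of \<open>x\<close> odd.
\<close>

definition reps :: "(nat \<times> nat) set" where
  "reps = {(1, 0), (1, 1)} \<union> (\<lambda>z. (2 * orbit_rep b z, 1)) ` orbit_index (Suc m) {..b}
     \<union> (\<lambda>z. (2, orbit_rep (Suc m) z)) ` orbit_index b {2..m}"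

lemma even_orbit_rep:
  "z \<in> orbit_index b {2..m} \<Longrightarrow> even (orbit_rep (Suc m) z)"
  by (auto simp: orbit_index_def orbit_rep_def)

lemma not_dvd_orbit_rep:
  assumes "z \<in> orbit_index b {2..m}"
  shows "\<not> 2 ^ m dvd orbit_rep (Suc m) z"
proof
  obtain n d where z: "z = (n, d)" "2 \<le> n" "n \<le> m" using assms by (auto simp: orbit_index_def)
  assume "2 ^ m dvd orbit_rep (Suc m) z"
  moreover have "(2::nat) ^ m = 2 ^ (Suc m - n) * 2 ^ (n - 1)" using z by (simp flip: power_add)
  ultimately have "2 ^ (Suc m - n) * 2 ^ (n - 1) dvd 2 ^ (Suc m - n) * (4 * d + 1)"
    by (simp only: orbit_rep_def z split)
  hence "2 ^ (n - 1) dvd 4 * d + 1"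
    by (metis dvd_times_left_cancel_iff power_not_zero zero_neq_numeral)
  moreover have "2 dvd (2::nat) ^ (n - 1)" using z by (intro dvd_power) auto
  ultimately show False by (metis dvd_trans even_add even_mult_iff even_numeral odd_one)
qed

lemma reps_nonsquare:
  assumes "(j, i) \<in> reps"
  shows "elt j i \<in> nonsquares G"
  using assms not_dvd_orbit_rep by (auto simp: reps_def nonsquare_elt_iff)

lemma cong_double_iff: "[2 * j = 2 * j'] (mod 2 ^ \<beta>) \<longleftrightarrow> [j = j'] (mod 2 ^ b)" for j j' :: nat
  by (simp add: \<beta>_def cong_def flip: mult_mod_right)

lemma reps_distinct:
  assumes "(j, i) \<in> reps" "(j', i') \<in> reps" "conj_odd_power G (elt j i) (elt j' i')"
  shows "(j, i) = (j', i')"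
proof -
  obtain u k where u: "odd u" "[j' = j * u] (mod 2 ^ \<beta>)" "even i' \<longleftrightarrow> even i"
    "even j \<Longrightarrow> [i' = i * u * r ^ k] (mod 2 ^ Suc m)"
    using conj_odd_power_elt_imp[OF assms(3)] by blast
  have ej: "even j' \<longleftrightarrow> even j"
    using cong_two_power_Suc_imp_parity[OF u(2)[unfolded \<beta>_def]] u(1) by simp
  consider (0) "(j, i) \<in> {(1, 0), (1, 1)}" "(j', i') \<in> {(1, 0), (1, 1)}"
    | (1) z z' where "z \<in> orbit_index (Suc m) {..b}" "z' \<in> orbit_index (Suc m) {..b}"
        "j = 2 * orbit_rep b z" "j' = 2 * orbit_rep b z'" "i = 1" "i' = 1"
    | (2) z z' where "z \<in> orbit_index b {2..m}" "z' \<in> orbit_index b {2..m}"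
        "i = orbit_rep (Suc m) z" "i' = orbit_rep (Suc m) z'" "j = 2" "j' = 2"
    using assms(1,2) ej u(3) unfolding reps_def by (auto dest: even_orbit_rep)
  thus ?thesis
  proof cases
    case 0
    thus ?thesis using u(3) by auto
  next
    case 1
    have "[1 = u * r ^ k] (mod 2 ^ Suc m)" using u(4) 1 by simp
    hence "[r ^ k * 1 = r ^ k * (u * r ^ k)] (mod 2 ^ Suc m)" by (intro cong_mult cong_refl)
    also have "r ^ k * (u * r ^ k) = u * r ^ (2 * k)" by (simp add: mult_2 power_add)
    also have "[u * r ^ (2 * k) = u * 1] (mod 2 ^ Suc m)"
      using r_pow_cong[of "2 * k"] by (intro cong_mult cong_refl) simp
    finally have "[u = r ^ k] (mod 2 ^ Suc m)" by (simp add: cong_sym_eq)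
    also note r_pow_cong[of k]
    finally have "[u = 1] (mod 2 ^ Suc m) \<or> [u = r] (mod 2 ^ Suc m)" by (metis (full_types))
    moreover have "[2 * orbit_rep b z' = 2 * (u * orbit_rep b z)] (mod 2 ^ \<beta>)"
      using u(2) 1 by (simp add: mult_ac)
    hence "[u * orbit_rep b z = orbit_rep b z'] (mod 2 ^ b)" unfolding cong_double_iff by (rule cong_sym)
    ultimately have "z = z'" using orbit_rep_unique[OF r_mod_4 order_refl u(1)] 1 by blast
    thus ?thesis using 1 by simp
  next
    case 2
    have "[2 * 1 = 2 * u] (mod 2 ^ \<beta>)" using u(2) 2 by simp
    hence u1: "[u = 1] (mod 2 ^ b)" unfolding cong_double_iff by (rule cong_sym)
    define w where "w = u * (if even k then 1 else r)"
    have "[w = 1 * (if even k then 1 else r)] (mod 2 ^ b)"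
      unfolding w_def using u1 by (intro cong_mult cong_refl)
    hence "[w = 1] (mod 2 ^ b) \<or> [w = r] (mod 2 ^ b)" by (metis (full_types) mult_1)
    moreover have "odd w" using u(1) odd_r by (simp add: w_def)
    moreover have "[w * orbit_rep (Suc m) z = orbit_rep (Suc m) z'] (mod 2 ^ Suc m)"
    proof -
      have "[i' = i * u * r ^ k] (mod 2 ^ Suc m)" using u(4) 2 by simp
      also have "[i * u * r ^ k = i * u * (if even k then 1 else r)] (mod 2 ^ Suc m)"
        by (intro cong_mult cong_refl r_pow_cong)
      finally show ?thesis using 2 by (simp add: w_def cong_sym_eq mult_ac)
    qed
    ultimately have "z = z'" using orbit_rep_unique[OF r_mod_4, of "{2..m}" "Suc m" w b] 2 by auto
    thus ?thesis using 2 by simp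
  qed
qed

lemma reps_cover:
  assumes "elt j i \<in> nonsquares G"
  shows "\<exists>p\<in>reps. conj_odd_power G (elt j i) (case p of (j', i') \<Rightarrow> elt j' i')"
proof -
  consider (0) "odd j" | (1) "even j" "odd i" | (2) "even j" "j mod 4 = 2" "even i" "\<not> 2 ^ m dvd i"
    using assms unfolding nonsquare_elt_iff by blast
  thus ?thesis
  proof cases
    case 0
    have "(1, i mod 2) \<in> reps" by (auto simp: reps_def)
    thus ?thesis using conj_odd_power_elt_odd[OF 0] by (intro bexI) simp_all
  next
    case 1
    obtain u0 where u0: "odd u0" "[i * u0 = 1] (mod 2 ^ Suc m)" using odd_inverse_mod_power_2[OF 1(2)] by blast
    obtain z u e where z: "z \<in> orbit_index (Suc m) {..b}" "odd u" "[u = 1] (mod 2 ^ Suc m)"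
      "[u * r ^ e * (j div 2 * u0) = orbit_rep b z] (mod 2 ^ b)"
      using orbit_rep_exists[OF r_mod_4] by blast
    \<comment> \<open>the unit \<open>r^e\<close> acts on the exponent of \<open>y\<close> through the power \<open>v\<close>; conjugation by \<open>y^e\<close> restores the exponent of \<open>x\<close>,
      as \<open>r^(2 e)\<close> is \<open>1\<close>\<close>
    define v where "v = u0 * u * r ^ e"
    have "[2 * orbit_rep b z = 2 * (u * r ^ e * (j div 2 * u0))] (mod 2 ^ \<beta>)"
      using z(4) unfolding cong_double_iff by (rule cong_sym)
    also have "2 * (u * r ^ e * (j div 2 * u0)) = (2 * (j div 2)) * v" by (simp add: v_def)
    finally have j: "[2 * orbit_rep b z = j * v] (mod 2 ^ \<beta>)" using 1 by simp
    have "i * v * r ^ e = (i * u0) * u * r ^ (2 * e)" by (simp add: v_def mult_2 power_add)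
    also have "[\<dots> = 1 * 1 * 1] (mod 2 ^ Suc m)"
      using r_pow_cong[of "2 * e"] by (intro cong_mult u0 z) simp
    finally have "[1 = i * v * r ^ e] (mod 2 ^ Suc m)" by (simp add: cong_sym_eq)
    moreover have "odd v" using u0 z odd_r by (simp add: v_def)
    ultimately have "conj_odd_power G (elt j i) (elt (2 * orbit_rep b z) 1)"
      using conj_odd_power_eltI j 1 by blast
    moreover have "(2 * orbit_rep b z, 1) \<in> reps" using z(1) by (auto simp: reps_def)
    ultimately show ?thesis by (intro bexI) simp_all
  next
    case 2
    define k where "k = j div 2"
    have k: "odd k" "j = 2 * k" using 2(1,2) unfolding k_def by presburger+
    obtain u0 where u0: "odd u0" "[k * u0 = 1] (mod 2 ^ b)" using odd_inverse_mod_power_2[OF k(1)] by blast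
    obtain z u e where z: "z \<in> orbit_index b {..Suc m}" "odd u" "[u = 1] (mod 2 ^ b)"
      "[u * r ^ e * (i * u0) = orbit_rep (Suc m) z] (mod 2 ^ Suc m)"
      using orbit_rep_exists[OF r_mod_4] by blast
    define v where "v = u0 * u"
    have v: "odd v" using u0 z by (simp add: v_def)
    have ri: "[orbit_rep (Suc m) z = i * v * r ^ e] (mod 2 ^ Suc m)"
      using cong_sym[OF z(4)] by (simp add: v_def mult_ac)
    have "[(k * u0) * u = 1 * 1] (mod 2 ^ b)" by (intro cong_mult u0 z)
    hence "[2 * 1 = 2 * (k * v)] (mod 2 ^ \<beta>)" unfolding cong_double_iff by (simp add: v_def cong_sym_eq mult_ac)
    hence "[2 = j * v] (mod 2 ^ \<beta>)" by (simp add: k(2) mult.assoc)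
    hence c: "conj_odd_power G (elt j i) (elt 2 (orbit_rep (Suc m) z))"
      using conj_odd_power_eltI[of j i v 2] 2 v ri by blast
    obtain n d where nd: "z = (n, d)" "n \<le> Suc m" "d < 2 ^ (min n b - 2)"
      using z(1) by (auto simp: orbit_index_def)
    have "even (orbit_rep (Suc m) z)" using cong_two_power_Suc_imp_parity[OF ri] 2 by simp
    hence "n \<noteq> Suc m" by (auto simp: nd orbit_rep_def)
    moreover have "\<not> 2 ^ m dvd orbit_rep (Suc m) z"
    proof -
      have "[orbit_rep (Suc m) z = i * v * r ^ e] (mod 2 ^ m)" using ri by (rule cong_dvd_modulus_nat) simp
      hence "2 ^ m dvd orbit_rep (Suc m) z \<longleftrightarrow> 2 ^ m dvd i * (v * r ^ e)" by (simp add: cong_dvd_iff mult.assoc)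
      also have "\<dots> \<longleftrightarrow> 2 ^ m dvd i"
        using v odd_r by (intro coprime_dvd_mult_left_iff) simp
      finally show ?thesis using 2 by simp
    qed
    hence "n \<ge> 2"
    proof -
      have "2 ^ m dvd orbit_rep (Suc m) z" if "n < 2"
        using that unfolding nd orbit_rep_def split by (intro dvd_mult2 le_imp_power_dvd) simp
      thus ?thesis using \<open>\<not> 2 ^ m dvd orbit_rep (Suc m) z\<close> by force
    qed
    ultimately have "z \<in> orbit_index b {2..m}" using nd by (simp add: orbit_index_def)
    hence "(2, orbit_rep (Suc m) z) \<in> reps" by (auto simp: reps_def)
    thus ?thesis using c by (intro bexI) simp_all
  qed
qed

lemma card_reps:
  "card reps = 2 + (\<Sum>n\<le>b. 2 ^ (min n (Suc m) - 2)) + (\<Sum>n=2..m. 2 ^ (min n b - 2))"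
proof -
  let ?A = "{(1, 0), (1, 1)} :: (nat \<times> nat) set"
  let ?B = "(\<lambda>z. (2 * orbit_rep b z, 1)) ` orbit_index (Suc m) {..b} :: (nat \<times> nat) set"
  let ?C = "(\<lambda>z. (2, orbit_rep (Suc m) z)) ` orbit_index b {2..m} :: (nat \<times> nat) set"
  have fin: "finite (orbit_index q N)" if "finite N" for q N using that by (simp add: orbit_index_def)
  have "card ?B = card (orbit_index (Suc m) {..b})"
    by (intro card_image inj_onI) (use inj_on_orbit_rep[of "{..b}" b "Suc m"] in \<open>auto dest: inj_onD\<close>)
  moreover have "card ?C = card (orbit_index b {2..m})"
    by (intro card_image inj_onI) (use inj_on_orbit_rep[of "{2..m}" "Suc m" b] in \<open>auto dest: inj_onD\<close>)
  moreover have "?A \<inter> ?B = {}" by auto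
  hence "card (?A \<union> ?B) = 2 + card ?B" using fin by (subst card_Un_disjoint) auto
  moreover have "(?A \<union> ?B) \<inter> ?C = {}"
  proof -
    have 1: "odd j \<or> odd i" if "(j, i) \<in> ?A \<union> ?B" for j i using that by auto
    have 2: "even j \<and> even i" if "(j, i) \<in> ?C" for j i using that even_orbit_rep by auto
    show ?thesis
    proof (rule equals0I)
      fix p assume "p \<in> (?A \<union> ?B) \<inter> ?C"
      moreover obtain j i where "p = (j, i)" by (cases p)
      ultimately show False using 1 2 by blast
    qed
  qed
  hence "card reps = card (?A \<union> ?B) + card ?C" unfolding reps_def using fin by (intro card_Un_disjoint) auto
  ultimately show ?thesis by (simp add: card_orbit_index)
qed

theorem eta_eq_sum:
  "eta G = 2 + (\<Sum>n\<le>b. 2 ^ (min n (Suc m) - 2)) + (\<Sum>n=2..m. 2 ^ (min n b - 2))"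
proof -
  let ?f = "\<lambda>(j, i). elt j i"
  have refl: "conj_odd_power G g g" if "g \<in> carrier G" for g
    using that unfolding conj_odd_power_def by (intro bexI[of _ \<one>] exI[of _ 1]) auto
  have "eta G = card (?f ` reps)"
  proof (rule eta_eq_card_representatives)
    show "?f ` reps \<noteq> {}" by (auto simp: reps_def)
    show "?f ` reps \<subseteq> nonsquares G" using reps_nonsquare by auto
    show "\<exists>g'\<in>?f ` reps. conj_odd_power G g g'" if gn: "g \<in> nonsquares G" for g
    proof -
      have "g \<in> carrier G" using gn by (simp add: nonsquares_def)
      then obtain j i where g: "g = elt j i" using carrier_elt by blast
      obtain p where "p \<in> reps" "conj_odd_power G g (?f p)"
        using reps_cover gn unfolding g by blast
      thus ?thesis by blast
    qed
    show "g = g'" if gg': "g \<in> ?f ` reps" "g' \<in> ?f ` reps" "conj_odd_power G g g'" for g g'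
    proof -
      obtain p q where pq: "p \<in> reps" "g = ?f p" "q \<in> reps" "g' = ?f q" using gg'(1,2) by blast
      obtain j i j' i' where "p = (j, i)" "q = (j', i')" by (cases p, cases q)
      thus ?thesis using reps_distinct[of j i j' i'] gg'(3) pq by simp
    qed
  qed
  also have "inj_on ?f reps"
  proof (rule inj_onI)
    fix p q assume "p \<in> reps" "q \<in> reps" "?f p = ?f q"
    moreover obtain j i j' i' where "p = (j, i)" "q = (j', i')" by (cases p, cases q)
    ultimately show "p = q" using reps_distinct[of j i j' i'] refl[of "elt j i"] by simp
  qed
  hence "card (?f ` reps) = card reps" by (rule card_image)
  finally show ?thesis using card_reps by simp
qed

end


section \<open>Evaluation of the sums\<close>

lemma sum_two_power_min_le:
  assumes "1 \<le> p" "p \<le> q"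
  shows "(\<Sum>n\<le>p. 2 ^ (min n q - 2)) = (1 + 2 ^ (p - 1) :: nat)"
  using assms
proof (induction p rule: dec_induct)
  case base
  show ?case by (simp add: min_def)
next
  case (step p)
  obtain t where "p = Suc t" using step by (cases p) auto
  thus ?case using step by simp
qed

lemma sum_two_power_min_ge:
  assumes "1 \<le> q"
  shows "(\<Sum>n\<le>q + t. 2 ^ (min n q - 2)) = (1 + 2 ^ (q - 1) + t * 2 ^ (q - 2) :: nat)"
  by (induction t) (use sum_two_power_min_le[of q q] assms in simp_all)

text \<open>
  The terms for \<open>n = 0\<close> and \<open>n = 1\<close> are both \<open>1\<close>; in the count they make the classes of \<open>y\<close> and
  \<open>y x\<close> take the places that the squares of these two elements would have had.
\<close>

lemma sum_from_2:
  assumes "2 \<le> m"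
  shows "2 + (\<Sum>n=2..m. 2 ^ (min n q - 2)) = (\<Sum>n\<le>m. 2 ^ (min n q - 2) :: nat)"
proof -
  have "{..m} = insert 0 (insert 1 {2..m})" using assms by auto
  thus ?thesis by (simp add: min_def)
qed

lemma sum_two_power_min_eq_g2:
  assumes "2 \<le> m" "2 \<le> b"
  shows "2 * ((\<Sum>n\<le>b. 2 ^ (min n (Suc m) - 2)) + (\<Sum>n\<le>m. 2 ^ (min n b - 2))) = g2 (Suc m) b + (4 :: nat)"
proof (cases "b \<le> m")
  case True
  then obtain t where t: "m = b + t" using le_Suc_ex by blast
  obtain c where c: "b = Suc (Suc c)" using assms(2) by (metis add_2_eq_Suc le_Suc_ex)
  show ?thesis
    using sum_two_power_min_le[of b "Suc m"] sum_two_power_min_ge[of b t] assms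
    by (simp add: g2_def Let_def t c algebra_simps)
next
  case False
  then obtain t where t: "b = Suc m + t" by (metis add_Suc_shift less_iff_Suc_add not_le add_Suc)
  obtain c where c: "m = Suc (Suc c)" using assms(1) by (metis add_2_eq_Suc le_Suc_ex)
  show ?thesis
    using sum_two_power_min_le[of m b] sum_two_power_min_ge[of "Suc m" t] assms
    by (simp add: g2_def Let_def t c algebra_simps)
qed


section \<open>Exponents of words in the presentation\<close>

primrec y_exponent :: "xy word \<Rightarrow> int" where
  "y_exponent [] = 0"
| "y_exponent (a # w) =
     (case a of (gen_x, _) \<Rightarrow> 0 | (gen_y, b) \<Rightarrow> if b then - 1 else 1) + y_exponent w"

definition twist :: "int \<Rightarrow> int \<Rightarrow> int" where
  "twist r j = (if even j then 1 else r)"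

text \<open>
  Moving the letters \<open>y\<close> of a word to the left turns each \<open>x\<close> into a power of \<open>x\<close> whose exponent
  is \<open>r\<close> to the number of letters \<open>y\<close> passed. Since \<open>r^2\<close> is \<open>1\<close> modulo \<open>2^(m + 1)\<close>, only the
  parity of that number matters, and it makes sense for negative numbers, too.
\<close>

primrec x_exponent :: "int \<Rightarrow> xy word \<Rightarrow> int" where
  "x_exponent r [] = 0"
| "x_exponent r (a # w) =
     (case a of (gen_x, b) \<Rightarrow> (if b then - 1 else 1) * twist r (y_exponent w) | (gen_y, _) \<Rightarrow> 0)
     + x_exponent r w"

lemma y_exponent_append: "y_exponent (u @ v) = y_exponent u + y_exponent v"
  by (induction u) auto

lemma twist_add:
  assumes "[r ^ 2 = 1] (mod N)"
  shows "[twist r (j + k) = twist r j * twist r k] (mod N)"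
  using cong_sym[OF assms] by (auto simp: twist_def power2_eq_square)

lemma x_exponent_append:
  assumes "[r ^ 2 = 1] (mod N)"
  shows "[x_exponent r (u @ v) = x_exponent r u * twist r (y_exponent v) + x_exponent r v] (mod N)"
proof (induction u)
  case (Cons a u)
  obtain s b where a: "a = (s, b)" by (cases a)
  show ?case
  proof (cases s)
    case gen_x
    define e :: int where "e = (if b then - 1 else 1)"
    have "x_exponent r ((a # u) @ v) = e * twist r (y_exponent u + y_exponent v) + x_exponent r (u @ v)"
      by (simp add: a gen_x e_def y_exponent_append)
    also have "[\<dots> = e * (twist r (y_exponent u) * twist r (y_exponent v))
        + (x_exponent r u * twist r (y_exponent v) + x_exponent r v)] (mod N)"
      by (intro cong_add cong_mult cong_refl Cons twist_add assms)
    also have "e * (twist r (y_exponent u) * twist r (y_exponent v))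
        + (x_exponent r u * twist r (y_exponent v) + x_exponent r v)
      = x_exponent r (a # u) * twist r (y_exponent v) + x_exponent r v"
      by (simp add: a gen_x e_def algebra_simps)
    finally show ?thesis .
  next
    case gen_y
    thus ?thesis using Cons by (simp add: a)
  qed
qed simp

lemma exponents_gen_pow:
  "y_exponent (gen_pow gen_y j @ w) = int j + y_exponent w"
  "x_exponent r (gen_pow gen_y j @ w) = x_exponent r w"
  "y_exponent (gen_pow gen_x i) = 0" "x_exponent r (gen_pow gen_x i) = int i"
proof -
  show "y_exponent (gen_pow gen_x i) = 0" for i by (induction i) (simp_all add: gen_pow_def)
  thus "x_exponent r (gen_pow gen_x i) = int i"
    by (induction i) (simp_all add: gen_pow_def twist_def)
  show "y_exponent (gen_pow gen_y j @ w) = int j + y_exponent w"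
    "x_exponent r (gen_pow gen_y j @ w) = x_exponent r w"
    by (induction j) (simp_all add: gen_pow_def)
qed

text \<open>
  The exponents modulo \<open>M\<close> and \<open>N\<close> are invariants of the presented group as soon as they respect
  its relators. In this way elements are told apart without constructing a model of the group.
  The modulus \<open>M\<close> has to be even because the parity of the exponent of \<open>y\<close> controls the twist.
\<close>

lemma word_cong_exponents:
  assumes "word_cong R u v" and r: "[r ^ 2 = 1] (mod N)" and M: "even M"
    and R: "\<And>u v. (u, v) \<in> R \<Longrightarrow>
      [y_exponent u = y_exponent v] (mod M) \<and> [x_exponent r u = x_exponent r v] (mod N)"
  shows "[y_exponent u = y_exponent v] (mod M) \<and> [x_exponent r u = x_exponent r v] (mod N)"
  using assms(1)
proof induction
  case (append u u' v v')
  have "[y_exponent v = y_exponent v'] (mod 2)" using append M by (blast intro: cong_dvd_modulus)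
  hence "even (y_exponent v) \<longleftrightarrow> even (y_exponent v')" by (metis cong_dvd_iff)
  hence t: "twist r (y_exponent v) = twist r (y_exponent v')" by (simp add: twist_def)
  have "[x_exponent r (u @ v) = x_exponent r u * twist r (y_exponent v) + x_exponent r v] (mod N)"
    by (rule x_exponent_append[OF r])
  also have "[x_exponent r u * twist r (y_exponent v) + x_exponent r v
      = x_exponent r u' * twist r (y_exponent v') + x_exponent r v'] (mod N)"
    unfolding t using append by (intro cong_add cong_mult cong_refl) auto
  also have "[x_exponent r u' * twist r (y_exponent v') + x_exponent r v' = x_exponent r (u' @ v')] (mod N)"
    by (rule cong_sym[OF x_exponent_append[OF r]])
  finally show ?case using append by (simp add: y_exponent_append cong_add)
next
  case (cancel s b)
  show ?case by (cases s) (auto simp: twist_def)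
qed (use R in \<open>auto intro: cong_sym cong_trans\<close>)

lemma presented_group_nat_pow:
  "word_class R (gen_word s) [^]\<^bsub>presented_group R\<^esub> (n::nat) = word_class R (gen_pow s n)"
proof (induction n)
  case 0
  show ?case by (simp add: gen_pow_def one_presented_group)
next
  case (Suc n)
  thus ?case
    by (simp add: mult_presented_group gen_word_def gen_pow_def replicate_append_same)
qed

text \<open>
  The letters and hence all words have the form \<open>y^j x^i\<close>; inverse letters are positive powers
  because every \<open>y^j x^i\<close> has 2-power order. That the exponents are determined follows from
  their invariance under the three relators: modulo \<open>2^(m + 1)\<close> both \<open>2^\<alpha>\<close> and \<open>2^(\<alpha> - \<epsilon>)\<close>
  vanish because \<open>\<delta> \<ge> 2\<close>.
\<close>

lemma negative_metacyclic_G2_neg: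
  assumes "\<epsilon> \<in> {0, 1}" "2 \<le> \<delta>" "\<delta> + 2 \<le> \<alpha>" "2 \<le> \<beta>"
  shows "\<exists>x y. negative_metacyclic (G2_neg \<alpha> \<beta> \<epsilon> \<delta>) x y \<alpha> \<beta> (\<alpha> - \<epsilon>) (2 ^ (\<alpha> - \<delta>) - 1) (\<alpha> - \<delta>) (\<beta> - 1)"
proof -
  define m where "m = \<alpha> - \<delta>"
  define r :: nat where "r = 2 ^ m - 1"
  have m: "2 \<le> m" "Suc m \<le> \<alpha> - \<epsilon>" "Suc m \<le> \<alpha>" using assms by (auto simp: m_def)
  define R where "R = {(gen_pow gen_x (2 ^ \<alpha>), []),
     (gen_pow gen_y (2 ^ \<beta>), gen_pow gen_x (2 ^ (\<alpha> - \<epsilon>))),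
     (inv_gen_word gen_y @ gen_word gen_x @ gen_word gen_y, gen_pow gen_x r)}"
  define G where "G = presented_group R"
  have G_eq: "G2_neg \<alpha> \<beta> \<epsilon> \<delta> = G" by (simp add: G2_neg_def G_def R_def r_def m_def)
  interpret group G unfolding G_def by (rule group_presented_group)
  define x where "x = word_class R (gen_word gen_x)"
  define y where "y = word_class R (gen_word gen_y)"
  have mult: "word_class R u \<otimes>\<^bsub>G\<^esub> word_class R v = word_class R (u @ v)" for u v
    unfolding G_def by (rule mult_presented_group)
  have one: "\<one>\<^bsub>G\<^esub> = word_class R []" unfolding G_def by (rule one_presented_group)
  have closed: "word_class R w \<in> carrier G" for w by (simp add: G_def carrier_presented_group)
  have xpow: "x [^]\<^bsub>G\<^esub> n = word_class R (gen_pow gen_x n)" for n :: nat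
    unfolding x_def G_def by (rule presented_group_nat_pow)
  have ypow: "y [^]\<^bsub>G\<^esub> n = word_class R (gen_pow gen_y n)" for n :: nat
    unfolding y_def G_def by (rule presented_group_nat_pow)
  have rel: "word_class R u = word_class R v" if "(u, v) \<in> R" for u v
    unfolding word_class_eq_iff using that by (rule word_cong.relation)
  have inverse: "word_class R [(s, \<not> c)] \<otimes>\<^bsub>G\<^esub> word_class R [(s, c)] = \<one>\<^bsub>G\<^esub>" for s c
    unfolding mult one word_class_eq_iff using word_cong.cancel[of R s "\<not> c"] by simp
  interpret metacyclic_relations G x y \<alpha> \<beta> "\<alpha> - \<epsilon>" r
  proof unfold_locales
    show "x \<in> carrier G" "y \<in> carrier G" by (simp_all add: x_def y_def closed)
    show "x [^]\<^bsub>G\<^esub> (2 ^ \<alpha> :: nat) = \<one>\<^bsub>G\<^esub>" unfolding xpow one by (rule rel) (simp add: R_def)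
    show "y [^]\<^bsub>G\<^esub> (2 ^ \<beta> :: nat) = x [^]\<^bsub>G\<^esub> (2 ^ (\<alpha> - \<epsilon>) :: nat)"
      unfolding xpow ypow by (rule rel) (simp add: R_def)
    have "word_class R (inv_gen_word gen_y) \<otimes>\<^bsub>G\<^esub> (x \<otimes>\<^bsub>G\<^esub> y) = x [^]\<^bsub>G\<^esub> r"
      unfolding x_def y_def mult xpow[unfolded x_def] by (rule rel) (simp add: R_def)
    hence "y \<otimes>\<^bsub>G\<^esub> x [^]\<^bsub>G\<^esub> r = (y \<otimes>\<^bsub>G\<^esub> word_class R (inv_gen_word gen_y)) \<otimes>\<^bsub>G\<^esub> (x \<otimes>\<^bsub>G\<^esub> y)"
      by (simp add: m_assoc x_def y_def closed)
    also have "y \<otimes>\<^bsub>G\<^esub> word_class R (inv_gen_word gen_y) = \<one>\<^bsub>G\<^esub>"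
      using inverse[of gen_y True] by (simp add: y_def gen_word_def inv_gen_word_def)
    finally show "x \<otimes>\<^bsub>G\<^esub> y = y \<otimes>\<^bsub>G\<^esub> x [^]\<^bsub>G\<^esub> r" by (simp add: x_def y_def closed)
  qed
  have letter: "\<exists>j i. word_class R [(s, c)] = elt j i" for s c
  proof -
    have "\<exists>j i. word_class R [(s, False)] = elt j i" for s
    proof (cases s)
      case gen_x
      have "elt 0 1 = x" by (simp add: elt_def)
      thus ?thesis using gen_x x_def gen_word_def by metis
    next
      case gen_y
      have "elt 1 0 = y" by (simp add: elt_def)
      thus ?thesis using gen_y y_def gen_word_def by metis
    qed
    then obtain j i where ji: "word_class R [(s, False)] = elt j i" by blast
    have "\<exists>j' i'. word_class R [(s, True)] = elt j' i'"
    proof -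
      define n :: nat where "n = 2 ^ (\<beta> + \<alpha>) - 1"
      have n: "2 ^ (\<beta> + \<alpha>) = Suc n" by (simp add: n_def)
      have "elt j i [^]\<^bsub>G\<^esub> n \<otimes>\<^bsub>G\<^esub> elt j i = \<one>\<^bsub>G\<^esub>" using elt_pow_exponent[of j i] unfolding n by simp
      moreover have "word_class R [(s, True)] \<otimes>\<^bsub>G\<^esub> elt j i = \<one>\<^bsub>G\<^esub>" using inverse[of s False] ji by simp
      ultimately have "word_class R [(s, True)] = elt j i [^]\<^bsub>G\<^esub> n"
        using inv_equality[of _ "elt j i"] closed by (metis elt_closed nat_pow_closed)
      moreover have "\<exists>j' i'. elt j i [^]\<^bsub>G\<^esub> n = elt j' i'" for n :: nat
      proof (induction n)
        case 0
        show ?case using elt_0_0 by (metis nat_pow_0)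
      next
        case (Suc n)
        thus ?case by (metis elt_mult nat_pow_Suc)
      qed
      ultimately show ?thesis by simp
    qed
    thus ?thesis using ji by (cases c) auto
  qed
  have generated: "\<exists>j i. word_class R w = elt j i" for w
  proof (induction w)
    case Nil
    show ?case using elt_0_0 one by metis
  next
    case (Cons a w)
    have "word_class R (a # w) = word_class R [a] \<otimes>\<^bsub>G\<^esub> word_class R w" by (simp add: mult)
    thus ?case using Cons letter[of "fst a" "snd a"] by (metis elt_mult prod.collapse)
  qed
  have r_int: "int r = 2 ^ m - 1" by (simp add: r_def of_nat_diff)
  have r_square: "[int r ^ 2 = 1] (mod 2 ^ Suc m)"
  proof -
    obtain t where t: "m = Suc t" using m by (cases m) auto
    have "int r ^ 2 - 1 = 2 ^ Suc m * (2 ^ t - 1)"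
      unfolding r_int by (simp add: t power2_eq_square algebra_simps)
    thus ?thesis by (simp add: cong_iff_dvd_diff)
  qed
  have sep: "[j = j'] (mod 2 ^ \<beta>) \<and> [i = i'] (mod 2 ^ Suc m)" if "elt j i = elt j' i'" for j i j' i'
  proof -
    let ?w = "\<lambda>j i. gen_pow gen_y j @ gen_pow gen_x i"
    have equal_words: "word_cong R (?w j i) (?w j' i')"
      using that unfolding elt_def xpow ypow mult word_class_eq_iff .
    have relators: "[y_exponent u = y_exponent v] (mod 2 ^ \<beta>) \<and>
        [x_exponent (int r) u = x_exponent (int r) v] (mod 2 ^ Suc m)"
      if uv: "(u, v) \<in> R" for u v
    proof -
      have two: "[2 ^ k = 0] (mod (2::int) ^ Suc m)" if "Suc m \<le> k" for k
        using le_imp_power_dvd[OF that, of 2] by (simp add: cong_0_iff)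
      consider "u = gen_pow gen_x (2 ^ \<alpha>)" "v = []"
        | "u = gen_pow gen_y (2 ^ \<beta>)" "v = gen_pow gen_x (2 ^ (\<alpha> - \<epsilon>))"
        | "u = inv_gen_word gen_y @ gen_word gen_x @ gen_word gen_y" "v = gen_pow gen_x r"
        using uv unfolding R_def by blast
      thus ?thesis
      proof cases
        case 1
        thus ?thesis using two[OF m(3)] by (simp add: exponents_gen_pow)
      next
        case 2
        have "y_exponent u = 2 ^ \<beta>" "x_exponent (int r) u = 0"
          using exponents_gen_pow(1,2)[where w = "[]"] 2(1) by simp_all
        moreover have "[2 ^ \<beta> = 0] (mod (2::int) ^ \<beta>)" by (simp add: cong_0_iff)
        ultimately show ?thesis using cong_sym[OF two[OF m(2)]] 2(2) by (simp add: exponents_gen_pow)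
      next
        case 3
        hence "y_exponent u = y_exponent v" "x_exponent (int r) u = x_exponent (int r) v"
          by (simp_all add: exponents_gen_pow inv_gen_word_def gen_word_def twist_def)
        thus ?thesis by simp
      qed
    qed
    have "[y_exponent (?w j i) = y_exponent (?w j' i')] (mod 2 ^ \<beta>) \<and>
      [x_exponent (int r) (?w j i) = x_exponent (int r) (?w j' i')] (mod 2 ^ Suc m)"
      by (rule word_cong_exponents[OF equal_words r_square _ relators]) (use assms(4) in auto)
    hence "[int j = int j'] (mod int (2 ^ \<beta>)) \<and> [int i = int i'] (mod int (2 ^ Suc m))"
      by (simp add: exponents_gen_pow)
    thus ?thesis by (simp only: cong_int_iff)
  qed
  have "negative_metacyclic G x y \<alpha> \<beta> (\<alpha> - \<epsilon>) r m (\<beta> - 1)"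
  proof unfold_locales
    show "\<exists>j i. g = elt j i" if "g \<in> carrier G" for g
      using that generated by (auto simp: G_def carrier_presented_group)
  qed (use m assms sep in \<open>auto simp: r_def\<close>)
  thus ?thesis unfolding G_eq r_def m_def by blast
qed

theorem corollary4p5:
  fixes \<alpha> \<beta> \<epsilon> \<delta> :: nat
  assumes "\<alpha> > 0" and "\<beta> > 0" and "\<epsilon> \<in> {0, 1}"
    and "\<delta> \<le> \<beta>" and "\<alpha> \<ge> \<delta> + 2" and "\<delta> + \<epsilon> \<le> \<alpha>"
    and "\<epsilon> = 1 \<longrightarrow> \<beta> \<ge> \<delta> + 1"
    and "\<delta> \<ge> 2"
  shows "(\<beta> = 2 \<longrightarrow> eta (G2_neg \<alpha> \<beta> \<epsilon> \<delta>) = \<alpha> - \<delta> + 3 \<and> \<alpha> - \<delta> + 3 = \<alpha> + 1)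
       \<and> (\<beta> \<ge> 3 \<longrightarrow> real (eta (G2_neg \<alpha> \<beta> \<epsilon> \<delta>)) = real (g2 (\<alpha> - \<delta> + 1) (\<beta> - 1)) / 2 + 2)"
proof -
  define m where "m = \<alpha> - \<delta>"
  define b where "b = \<beta> - 1"
  have m: "2 \<le> m" using assms by (simp add: m_def)
  obtain x y where "negative_metacyclic (G2_neg \<alpha> \<beta> \<epsilon> \<delta>) x y \<alpha> \<beta> (\<alpha> - \<epsilon>) (2 ^ m - 1) m b"
    using negative_metacyclic_G2_neg[of \<epsilon> \<delta> \<alpha> \<beta>] assms unfolding m_def b_def by auto
  hence eta: "eta (G2_neg \<alpha> \<beta> \<epsilon> \<delta>) =
      (\<Sum>n\<le>b. 2 ^ (min n (Suc m) - 2)) + (\<Sum>n\<le>m. 2 ^ (min n b - 2))"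
    using negative_metacyclic.eta_eq_sum sum_from_2[OF m, of b] by fastforce
  show ?thesis
  proof (intro conjI impI)
    assume "\<beta> = 2"
    hence "b = 1" "\<delta> = 2" using assms by (simp_all add: b_def)
    obtain t where t: "m = 1 + t" using m le_Suc_ex[of 1 m] by auto
    show "eta (G2_neg \<alpha> \<beta> \<epsilon> \<delta>) = \<alpha> - \<delta> + 3"
      unfolding eta \<open>b = 1\<close> m_def[symmetric]
      using sum_two_power_min_le[of 1 "Suc m"] sum_two_power_min_ge[of 1 t] t by simp
    show "\<alpha> - \<delta> + 3 = \<alpha> + 1" using \<open>\<delta> = 2\<close> assms by simp
  next
    assume "\<beta> \<ge> 3"
    hence "2 * eta (G2_neg \<alpha> \<beta> \<epsilon> \<delta>) = g2 (Suc m) b + 4"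
      unfolding eta using m by (intro sum_two_power_min_eq_g2) (auto simp: b_def)
    hence "2 * real (eta (G2_neg \<alpha> \<beta> \<epsilon> \<delta>)) = real (g2 (Suc m) b) + 4"
      by (metis of_nat_add of_nat_mult of_nat_numeral)
    thus "real (eta (G2_neg \<alpha> \<beta> \<epsilon> \<delta>)) = real (g2 (\<alpha> - \<delta> + 1) (\<beta> - 1)) / 2 + 2"
      by (simp add: m_def b_def)
  qed
qed

end
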